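(* Let $\mathtt{n}=(n_i)_{i\ge 0}$ be a sequence of non-negative integers with $\sum_{i\ge 0}n_i=1+\sum_{i\ge 0}i\,n_i=n$, where $n\ge 3$. Let $T_{\mathtt{n}}$ be a uniformly random plane tree with type $\mathtt{n}$. Then for all $s>0$, \[\mathbb{P}\big(\mathrm{Wd}(T_{\mathtt{n}})\,\mathrm{Ht}(T_{\mathtt{n}})\ge s\,n\log n\big)\le 230\,s^{-2/13}.\]
   Context: A plane tree is a finite rooted tree in which the children of every vertex are linearly ordered. A plane tree $t$ has type $\mathtt{n}=(n_i)_{i\ge 0}$ if for every $i\ge 0$, $t$ contains exactly $n_i$ vertices with $i$ children. The height $\mathrm{Ht}(t)$ is the maximum graph distance of a vertex of $t$ to the root, and the width $\mathrm{Wd}(t)$ is the maximum over $h\ge 0$ of the number of vertices at distance exactly $h$ from the root. $\log$ is the natural logarithm. *)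

theory Defs
  imports "HOL-Probability.Probability"
begin

datatype plane_tree = Node (children: "plane_tree list")

text \<open>
  Vertices are addressed by their position (Ulam--Harris notation): the root is the empty list, and
  the \<open>i\<close>-th child (counting from 0) of the vertex \<open>v\<close> is \<open>v @ [i]\<close>. Hence the graph distance of a
  vertex to the root is the length of its address.
\<close>

fun is_vertex :: "plane_tree \<Rightarrow> nat list \<Rightarrow> bool" where
  "is_vertex t [] \<longleftrightarrow> True"
| "is_vertex t (i # v) \<longleftrightarrow> i < length (children t) \<and> is_vertex (children t ! i) v"

definition vertices :: "plane_tree \<Rightarrow> nat list set" where
  "vertices t = {v. is_vertex t v}"

text \<open>Only meaningful if the address is a vertex of the tree.\<close>

fun subtree_at :: "plane_tree \<Rightarrow> nat list \<Rightarrow> plane_tree" where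
  "subtree_at t [] = t"
| "subtree_at t (i # v) = subtree_at (children t ! i) v"

definition num_children :: "plane_tree \<Rightarrow> nat list \<Rightarrow> nat" where
  "num_children t v = length (children (subtree_at t v))"

definition has_type :: "plane_tree \<Rightarrow> (nat \<Rightarrow> nat) \<Rightarrow> bool" where
  "has_type t N \<longleftrightarrow> (\<forall>i. card {v \<in> vertices t. num_children t v = i} = N i)"

definition tree_height :: "plane_tree \<Rightarrow> nat" where
  "tree_height t = Max (length ` vertices t)"

definition tree_width :: "plane_tree \<Rightarrow> nat" where
  "tree_width t = Max (range (\<lambda>h. card {v \<in> vertices t. length v = h}))"

lemma vertices_Node:
  "vertices (Node ts) = insert [] (\<Union>i<length ts. (#) i ` vertices (ts ! i))"
proof -
  have "is_vertex (Node ts) v \<longleftrightarrow> v \<in> insert [] (\<Union>i<length ts. (#) i ` vertices (ts ! i))" for v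
    by (cases v) (auto simp: vertices_def)
  then show ?thesis
    unfolding vertices_def[of "Node ts"] by blast
qed

lemma finite_vertices: "finite (vertices t)"
  by (induction t) (auto simp: vertices_Node)

text \<open>The maxima in \<open>tree_height\<close> and \<open>tree_width\<close> are taken over finite non-empty sets.\<close>

lemma finite_lengths: "finite (length ` vertices t)" "length ` vertices t \<noteq> {}"
proof -
  have "[] \<in> vertices t" by (simp add: vertices_def)
  then show "length ` vertices t \<noteq> {}" by blast
qed (simp add: finite_vertices)

lemma finite_level_sizes: "finite (range (\<lambda>h. card {v \<in> vertices t. length v = h}))"
proof (rule finite_subset)
  show "range (\<lambda>h. card {v \<in> vertices t. length v = h}) \<subseteq> {..card (vertices t)}"
    by (auto intro!: card_mono finite_vertices)
qed simp

end

(*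
  Let M be the multiset of the n numbers of children, v the sum of (c - 1)^2 over c in M, and D = v - 1
  the sum of c (c - 1). The scale of the width is sqrt v, that of the height is n / sqrt v, and the
  factor ln n only enters through a union bound over the vertices.

  Width: the breadth-first queue of a random tree is, by the cycle lemma, a rotation of the bridge
  whose steps c - 1 are in uniformly random order. A level size is a value of the queue, hence at most
  the range of the bridge up to a constant, and a Kolmogorov type inequality for sampling without
  replacement bounds the probability that the width is at least w by 160 v / w^2.

  Height: peeling off the ancestors of a marked vertex one at a time, the expected size of level h is at
  most n e_h / (n choose h), where e_h is the elementary symmetric polynomial of M (up to the factor, the
  probability that a random word in which each vertex occurs as often as it has children starts with h
  distinct letters). Estimating e_h by z^(-h) times the product of all 1 + c z, with z = h / (n - 1 - h),
  bounds it by n^2 exp (- D z^2 / (4 (1 + z + z sqrt D))), which is at most 1 / n as soon as h is at least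
  36 n ln n / sqrt v.

  The resulting bound 2 / s, valid for s at least 10^7, is stronger than the one claimed.
*)

theory Submission
  imports Defs "HOL-Combinatorics.Multiset_Permutations" "HOL-Computational_Algebra.Polynomial"
begin

subsection \<open>Degrees and level sizes\<close>

text \<open>A multiset in place of the counting function \<open>N\<close>: its orderings are
  available as \<open>permutations_of_multiset\<close>, and deleting a vertex is multiset
  subtraction.\<close>

fun degs :: "plane_tree \<Rightarrow> nat multiset" where
  "degs (Node ts) = add_mset (length ts) (sum_list (map degs ts))"

abbreviation forest_degs :: "plane_tree list \<Rightarrow> nat multiset" where
  "forest_degs ts \<equiv> sum_list (map degs ts)"

definition level_size :: "nat \<Rightarrow> plane_tree \<Rightarrow> nat" where
  "level_size h t = card {v \<in> vertices t. length v = h}"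

text \<open>One recursion for three counts: vertices with a given number of children, all vertices,
  and vertices on a given level.\<close>

lemma card_vertices_Node:
  "card {v \<in> vertices (Node ts). P v}
     = (if P [] then 1 else 0) + (\<Sum>t\<leftarrow>map (\<lambda>i. card {v \<in> vertices (ts ! i). P (i # v)}) [0..<length ts]. t)"
proof -
  let ?B = "\<lambda>i. (#) i ` {v \<in> vertices (ts ! i). P (i # v)}"
  have eq: "{v \<in> vertices (Node ts). P v} = {v. v = [] \<and> P []} \<union> (\<Union>i<length ts. ?B i)"
    unfolding vertices_Node by auto
  have "card {v \<in> vertices (Node ts). P v} = card {v::nat list. v = [] \<and> P []} + card (\<Union>i<length ts. ?B i)"
    unfolding eq by (rule card_Un_disjoint) (auto simp: finite_vertices)
  also have "card (\<Union>i<length ts. ?B i) = (\<Sum>i<length ts. card (?B i))"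
    by (rule card_UN_disjoint) (auto simp: finite_vertices)
  also have "\<dots> = (\<Sum>i<length ts. card {v \<in> vertices (ts ! i). P (i # v)})"
    by (intro sum.cong refl card_image) auto
  also have "card {v::nat list. v = [] \<and> P []} = (if P [] then 1 else 0)"
    by auto
  finally show ?thesis
    by (simp add: interv_sum_list_conv_sum_set_nat atLeast0LessThan)
qed

lemma card_num_children_eq_count: "card {v \<in> vertices t. num_children t v = i} = count (degs t) i"
proof (induction t)
  case (Node ts)
  have count_sum_list: "count (sum_list Ms) i = (\<Sum>M\<leftarrow>Ms. count M i)" for Ms
    by (induction Ms) auto
  have "map (\<lambda>j. card {v \<in> vertices (ts ! j). num_children (Node ts) (j # v) = i}) [0..<length ts]
     = map (\<lambda>t. count (degs t) i) ts"
    by (rule nth_equalityI) (auto simp: Node.IH[symmetric] num_children_def)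
  then show ?case
    by (simp add: card_vertices_Node count_sum_list o_def) (simp add: num_children_def)
qed

lemma card_vertices: "card (vertices t) = size (degs t)"
proof (induction t)
  case (Node ts)
  have size_sum_list: "size (sum_list Ms) = (\<Sum>M\<leftarrow>Ms. size M)" for Ms :: "nat multiset list"
    by (induction Ms) auto
  have "map (\<lambda>j. card {v \<in> vertices (ts ! j). True}) [0..<length ts] = map (\<lambda>t. size (degs t)) ts"
    by (rule nth_equalityI) (auto simp: Node.IH[symmetric])
  then show ?case
    using card_vertices_Node[of ts "\<lambda>_. True"] by (simp add: size_sum_list o_def)
qed

lemma level_size_0 [simp]: "level_size 0 t = 1"
proof -
  have "{v \<in> vertices t. length v = 0} = {[]}"
    by (auto simp: vertices_def)
  then show ?thesis by (simp add: level_size_def)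
qed

lemma level_size_Suc: "level_size (Suc h) t = (\<Sum>u\<leftarrow>children t. level_size h u)"
proof (cases t)
  case (Node ts)
  have "map (\<lambda>j. card {v \<in> vertices (ts ! j). length (j # v) = Suc h}) [0..<length ts] = map (level_size h) ts"
    by (rule nth_equalityI) (auto simp: level_size_def)
  then show ?thesis
    using card_vertices_Node[of ts "\<lambda>v. length v = Suc h"] Node by (simp add: level_size_def[of "Suc h"])
qed

lemma level_size_le: "level_size h t \<le> size (degs t)"
  unfolding level_size_def card_vertices[symmetric] by (intro card_mono finite_vertices) auto

lemma take_in_vertices: "v \<in> vertices t \<Longrightarrow> take j v \<in> vertices t"
proof (induction v arbitrary: t j)
  case (Cons i v)
  then show ?case by (cases j) (auto simp: vertices_def)
qed simp

lemma level_size_pos: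
  assumes "h \<le> tree_height t"
  shows "level_size h t > 0"
proof -
  have "tree_height t \<in> length ` vertices t"
    unfolding tree_height_def by (intro Max_in finite_lengths)
  then obtain v where "v \<in> vertices t" "length v = tree_height t" by auto
  then have "take h v \<in> {v \<in> vertices t. length v = h}"
    using assms take_in_vertices by auto
  then show ?thesis
    unfolding level_size_def by (auto simp: card_gt_0_iff finite_vertices)
qed

lemma tree_height_le: "tree_height t \<le> size (degs t)"
proof -
  have "tree_height t \<in> length ` vertices t"
    unfolding tree_height_def by (intro Max_in finite_lengths)
  then obtain v where v: "v \<in> vertices t" "length v = tree_height t" by auto
  have "inj_on (\<lambda>j. take j v) {..length v}"
    by (metis (no_types, lifting) atMost_iff inj_onI length_take min.absorb2)
  then have "card {..length v} = card ((\<lambda>j. take j v) ` {..length v})"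
    by (simp add: card_image)
  also have "\<dots> \<le> card (vertices t)"
    using v(1) by (intro card_mono finite_vertices) (auto simp: take_in_vertices)
  finally show ?thesis using v(2) by (simp add: card_vertices)
qed

lemma tree_width_eq: "\<exists>h. tree_width t = level_size h t"
proof -
  have "tree_width t \<in> range (\<lambda>h. card {v \<in> vertices t. length v = h})"
    unfolding tree_width_def by (intro Max_in finite_level_sizes) auto
  then show ?thesis by (auto simp: level_size_def)
qed

subsection \<open>Breadth-first coding\<close>

text \<open>The argument is the queue of roots still to be explored. Children join at the back, so
  generations are explored one after another.\<close>

function bfs :: "plane_tree list \<Rightarrow> nat list" where
  "bfs [] = []"
| "bfs (t # ts) = length (children t) # bfs (ts @ children t)"
  by pat_completeness auto
termination
proof (relation "Wellfounded.measure (\<lambda>ts. size (forest_degs ts))")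
  fix t ts show "(ts @ children t, t # ts) \<in> Wellfounded.measure (\<lambda>ts. size (forest_degs ts))"
    by (cases t) simp
qed simp

text \<open>\<open>first_passage k xs\<close>: a queue of length \<open>k\<close> that loses one element and gains \<open>c\<close> at each entry
  \<open>c\<close> of \<open>xs\<close> becomes empty for the first time at the end of \<open>xs\<close>.\<close>

fun first_passage :: "nat \<Rightarrow> nat list \<Rightarrow> bool" where
  "first_passage k [] \<longleftrightarrow> k = 0"
| "first_passage k (c # xs) \<longleftrightarrow> k > 0 \<and> first_passage (k - 1 + c) xs"

lemma mset_bfs: "mset (bfs ts) = forest_degs ts"
proof (induction ts rule: bfs.induct)
  case (2 t ts)
  then show ?case by (cases t) simp
qed simp

lemma first_passage_bfs: "first_passage (length ts) (bfs ts)"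
  by (induction ts rule: bfs.induct) auto

text \<open>The first entry tells how many trees at the end of the new queue are children of the
  removed root, so each call can be undone.\<close>

lemma bfs_inject: "length ts = length us \<Longrightarrow> bfs ts = bfs us \<Longrightarrow> ts = us"
proof (induction ts arbitrary: us rule: bfs.induct)
  case (2 t ts)
  then obtain u us' where us: "us = u # us'" by (cases us) auto
  have len: "length (children t) = length (children u)" "length ts = length us'"
    using 2 us by auto
  have "ts @ children t = us' @ children u"
    by (rule "2.IH") (use 2 us len in auto)
  then show ?case using us len by (cases t; cases u) auto
qed auto

text \<open>Decoding from the right: an entry \<open>c\<close> gathers the last \<open>c\<close>
  trees of the queue under a new root placed in front.\<close>

lemma bfs_surj: "first_passage k xs \<Longrightarrow> \<exists>ts. length ts = k \<and> bfs ts = xs"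
proof (induction k xs rule: first_passage.induct)
  case (2 k c xs)
  then obtain ts where ts: "length ts = k - 1 + c" "bfs ts = xs" by auto
  then have "length (Node (drop (k - 1) ts) # take (k - 1) ts) = k
      \<and> bfs (Node (drop (k - 1) ts) # take (k - 1) ts) = c # xs"
    using 2 by auto
  then show ?case by blast
qed auto

definition forests :: "nat \<Rightarrow> nat multiset \<Rightarrow> plane_tree list set" where
  "forests k M = {ts. length ts = k \<and> forest_degs ts = M}"

lemma bij_betw_bfs:
  "bij_betw bfs (forests k M) {xs \<in> permutations_of_multiset M. first_passage k xs}"
proof (rule bij_betw_imageI)
  show "inj_on bfs (forests k M)"
    by (auto simp: forests_def inj_on_def intro: bfs_inject)
  show "bfs ` forests k M = {xs \<in> permutations_of_multiset M. first_passage k xs}"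
  proof (intro subset_antisym subsetI)
    fix xs assume "xs \<in> bfs ` forests k M"
    then show "xs \<in> {xs \<in> permutations_of_multiset M. first_passage k xs}"
      by (auto simp: forests_def permutations_of_multiset_def mset_bfs first_passage_bfs)
  next
    fix xs assume "xs \<in> {xs \<in> permutations_of_multiset M. first_passage k xs}"
    then obtain ts where "length ts = k" "bfs ts = xs" "mset xs = M"
      using bfs_surj by (auto simp: permutations_of_multiset_def)
    then show "xs \<in> bfs ` forests k M"
      using mset_bfs[of ts] by (auto simp: forests_def)
  qed
qed

lemma finite_forests: "finite (forests k M)"
  using bij_betw_finite[OF bij_betw_bfs[of k M]] by simp

lemma card_forests_le: "card (forests k M) \<le> card (permutations_of_multiset M)"
  unfolding bij_betw_same_card[OF bij_betw_bfs[of k M]] by (intro card_mono) auto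

lemma bfs_append: "bfs (ts @ us) = map (length \<circ> children) ts @ bfs (us @ concat (map children ts))"
  by (induction ts arbitrary: us) auto

text \<open>The level sizes are the queue lengths at the times at which a new generation starts.\<close>

lemma level_size_queue:
  "\<exists>j \<le> length (bfs ts). int (\<Sum>t\<leftarrow>ts. level_size h t) = int (length ts) + (\<Sum>c\<leftarrow>take j (bfs ts). int c - 1)"
proof (induction h arbitrary: ts)
  case 0
  show ?case by (rule exI[of _ 0]) (simp add: sum_list_triv)
next
  case (Suc h)
  let ?us = "concat (map children ts)"
  obtain j where j: "j \<le> length (bfs ?us)"
      "int (\<Sum>t\<leftarrow>?us. level_size h t) = int (length ?us) + (\<Sum>c\<leftarrow>take j (bfs ?us). int c - 1)"
    using Suc by blast
  have sizes: "(\<Sum>t\<leftarrow>ts. level_size (Suc h) t) = (\<Sum>t\<leftarrow>?us. level_size h t)"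
    by (induction ts) (auto simp: level_size_Suc)
  have len: "int (length ?us) = int (length ts) + (\<Sum>c\<leftarrow>map (length \<circ> children) ts. int c - 1)"
    by (induction ts) auto
  \<comment> \<open>The first \<open>length ts\<close> entries read off the current generation and
    leave exactly the next one in the queue, hence the time shift by
    \<open>length ts\<close>.\<close>
  have "bfs ts = map (length \<circ> children) ts @ bfs ?us"
    using bfs_append[of ts "[]"] by simp
  then show ?case
    using j by (intro exI[of _ "length ts + j"]) (simp add: sizes len)
qed

subsection \<open>The cycle lemma\<close>

abbreviation step :: "nat \<Rightarrow> real" where
  "step c \<equiv> real c - 1"

lemma first_passage_sum: "first_passage k xs \<Longrightarrow> real k + (\<Sum>c\<leftarrow>xs. step c) = 0"
proof (induction k xs rule: first_passage.induct)
  case (2 k c xs)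
  then have "real (k - 1 + c) + (\<Sum>c\<leftarrow>xs. step c) = 0" "k > 0" by auto
  then show ?case by (simp add: of_nat_diff)
qed simp

text \<open>The form in which rotations can be compared. Real steps avoid the truncated subtraction
  in \<open>k - 1\<close>.\<close>

lemma first_passage_iff:
  "first_passage k xs \<longleftrightarrow>
     real k + (\<Sum>c\<leftarrow>xs. step c) = 0 \<and> (\<forall>j<length xs. real k + (\<Sum>c\<leftarrow>take j xs. step c) > 0)"
proof (induction k xs rule: first_passage.induct)
  case (2 k c xs)
  show ?case
  proof (cases "k > 0")
    case True
    then have "real (k - 1 + c) = real k + step c" by (simp add: of_nat_diff)
    moreover have "(\<forall>j<length (c # xs). P j) \<longleftrightarrow> P 0 \<and> (\<forall>j<length xs. P (Suc j))" for P
      by (auto simp: less_Suc_eq_0_disj)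
    ultimately show ?thesis
      using True "2.IH" by (simp add: algebra_simps)
  next
    case False
    then show ?thesis by force
  qed
qed simp

lemma first_passage_append_nonneg:
  assumes "first_passage 1 (us @ vs)" "vs \<noteq> []"
  shows "(\<Sum>c\<leftarrow>us. step c) \<ge> 0"
proof -
  \<comment> \<open>integrality turns \<open>> - 1\<close> into \<open>\<ge> 0\<close>\<close>
  have int: "(\<Sum>c\<leftarrow>us. step c) = of_int (\<Sum>c\<leftarrow>us. int c - 1)"
    by (induction us) auto
  have "\<forall>j<length (us @ vs). 1 + (\<Sum>c\<leftarrow>take j (us @ vs). step c) > 0"
    using assms(1) first_passage_iff[of 1 "us @ vs"] by simp
  then have "1 + (\<Sum>c\<leftarrow>us. step c) > 0"
    using assms(2) by (elim allE[of _ "length us"]) simp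
  then have "(\<Sum>c\<leftarrow>us. int c - 1) \<ge> 0"
    unfolding int by linarith
  then show ?thesis unfolding int by simp
qed

text \<open>If \<open>r\<close> were positive, both pieces exchanged by the rotation would be proper
  prefixes of first passage lists, hence have nonnegative sums, although the total is - 1.\<close>

lemma first_passage_rotate_unique:
  assumes "first_passage 1 xs" "first_passage 1 (rotate r xs)" "r < length xs"
  shows "r = 0"
proof (rule ccontr)
  assume "r \<noteq> 0"
  define us vs where "us = take r xs" and "vs = drop r xs"
  have xs: "xs = us @ vs" "rotate r xs = vs @ us" "us \<noteq> []" "vs \<noteq> []"
    using assms(3) \<open>r \<noteq> 0\<close> by (auto simp: us_def vs_def rotate_drop_take)
  have "(\<Sum>c\<leftarrow>us. step c) \<ge> 0" "(\<Sum>c\<leftarrow>vs. step c) \<ge> 0"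
    using assms(1,2) xs first_passage_append_nonneg by metis+
  moreover have "1 + (\<Sum>c\<leftarrow>xs. step c) = 0"
    using first_passage_sum[OF assms(1)] by simp
  ultimately show False using xs(1) by simp
qed

text \<open>Rotate to the first position at which the partial sums attain their minimum.\<close>

lemma first_passage_rotate_exists:
  assumes sum: "(\<Sum>c\<leftarrow>xs. step c) = - 1"
  shows "\<exists>r. first_passage 1 (rotate r xs)"
proof -
  define S where "S j = (\<Sum>c\<leftarrow>take j xs. int c - 1)" for j
  have real_S: "(\<Sum>c\<leftarrow>take j xs. step c) = of_int (S j)" for j
    unfolding S_def by (induction xs arbitrary: j) (auto simp: take_Cons')
  have S_total: "S (length xs) = - 1"
    using real_S[of "length xs"] sum by simp
  define m where "m = Min (S ` {..length xs})"
  have m_le: "m \<le> S j" if "j \<le> length xs" for j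
    unfolding m_def using that by (intro Min_le) auto
  have "m \<in> S ` {..length xs}"
    unfolding m_def by (intro Min_in) auto
  then have ex: "\<exists>r. r \<le> length xs \<and> S r = m" by auto
  \<comment> \<open>The earliest minimum makes \<open>S j > m\<close> strict for
    \<open>j < r\<close>; this keeps the queue nonempty after the rotated list wraps around.\<close>
  define r where "r = (LEAST r. r \<le> length xs \<and> S r = m)"
  have r: "r \<le> length xs" "S r = m"
    using LeastI_ex[OF ex] unfolding r_def by auto
  have less: "S j > m" if "j < r" for j
  proof -
    have "j \<le> length xs" using that r(1) by simp
    then show ?thesis
      using not_less_Least[of j "\<lambda>r. r \<le> length xs \<and> S r = m"] that m_le[of j]
      unfolding r_def by force
  qed
  have r_pos: "r > 0"
  proof (rule ccontr)
    assume "\<not> r > 0"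
    then have "S 0 = m" using r by simp
    then show False using m_le[of "length xs"] S_total by (simp add: S_def)
  qed
  define us vs where "us = take r xs" and "vs = drop r xs"
  have rot: "rotate r xs = vs @ us"
  proof (cases "r = length xs")
    case False
    then show ?thesis using r by (simp add: us_def vs_def rotate_drop_take)
  qed (simp add: us_def vs_def)
  have xs: "xs = us @ vs" and len_us: "length us = r"
    using r by (auto simp: us_def vs_def)
  have vs_prefix: "(\<Sum>c\<leftarrow>take j vs. step c) = of_int (S (r + j) - m)" for j
  proof -
    have "(\<Sum>c\<leftarrow>take (r + j) xs. step c) = (\<Sum>c\<leftarrow>take r xs. step c) + (\<Sum>c\<leftarrow>take j vs. step c)"
      by (simp add: take_add vs_def)
    then show ?thesis unfolding real_S using r by simp
  qed
  have "first_passage 1 (vs @ us)"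
    unfolding first_passage_iff
  proof (intro conjI allI impI)
    show "real 1 + (\<Sum>c\<leftarrow>vs @ us. step c) = 0"
      using sum by (simp add: xs)
    fix j assume j: "j < length (vs @ us)"
    show "real 1 + (\<Sum>c\<leftarrow>take j (vs @ us). step c) > 0"
    proof (cases "j \<le> length vs")
      case True
      then have "S (r + j) \<ge> m"
        using xs len_us by (intro m_le) simp
      then show ?thesis
        using True vs_prefix[of j] by simp
    next
      case False
      define i where "i = j - length vs"
      have i: "i < r" "i \<le> length us"
        using False j len_us by (auto simp: i_def)
      have "(\<Sum>c\<leftarrow>vs. step c) = of_int (- 1 - m)"
        using vs_prefix[of "length vs"] S_total xs len_us by simp
      moreover have "(\<Sum>c\<leftarrow>take i us. step c) = of_int (S i)"
        using i len_us xs real_S[of i] by simp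
      ultimately have "(\<Sum>c\<leftarrow>take j (vs @ us). step c) = of_int (S i - m - 1)"
        using False by (simp add: i_def)
      then show ?thesis using less[OF i(1)] by simp
    qed
  qed
  then show ?thesis using rot by metis
qed

lemma mset_rotate [simp]: "mset (rotate r xs) = mset xs"
  by (metis add.commute append_take_drop_id mset_append rotate_drop_take)

text \<open>The cycle lemma as a bijection: a uniform first passage list, rotated by an independent
  uniform amount, is a uniform ordering of \<open>M\<close>.\<close>

lemma bij_betw_rotate:
  assumes sum: "(\<Sum>c\<in>#M. step c) = - 1"
  shows "bij_betw (\<lambda>(r, xs). rotate r xs)
     ({..<size M} \<times> {xs \<in> permutations_of_multiset M. first_passage 1 xs}) (permutations_of_multiset M)"
proof (rule bij_betw_imageI)
  let ?F = "{xs \<in> permutations_of_multiset M. first_passage 1 xs}"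
  have len: "length xs = size M" if "xs \<in> permutations_of_multiset M" for xs
    using that by (auto simp: permutations_of_multiset_def)
  have *: "r = s \<and> xs = ys"
    if "r < size M" "s < size M" "r \<le> s" "xs \<in> ?F" "ys \<in> ?F" "rotate r xs = rotate s ys" for r s xs ys
  proof -
    have "xs = rotate (size M - r) (rotate r xs)"
      using that(1,4) len[of xs] by (simp add: rotate_rotate)
    also have "\<dots> = rotate (size M - r + s) ys"
      unfolding that(6) by (simp only: rotate_rotate)
    also have "size M - r + s = size M + (s - r)" using that by simp
    also have "rotate (size M + (s - r)) ys = rotate (s - r) (rotate (size M) ys)"
      by (simp only: rotate_rotate add.commute)
    also have "rotate (size M) ys = ys"
      using that(5) len[of ys] by (intro rotate_id) simp
    finally have xs: "xs = rotate (s - r) ys" .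
    then have "s - r = 0"
      using that len[of ys] by (intro first_passage_rotate_unique[of ys]) auto
    then show ?thesis using xs that by simp
  qed
  show "inj_on (\<lambda>(r, xs). rotate r xs) ({..<size M} \<times> ?F)"
  proof (rule inj_onI, clarify)
    fix r xs s ys
    assume "r < size M" "s < size M" "rotate r xs = rotate s ys"
      "xs \<in> permutations_of_multiset M" "first_passage 1 xs"
      "ys \<in> permutations_of_multiset M" "first_passage 1 ys"
    then show "r = s \<and> xs = ys"
      using *[of r s xs ys] *[of s r ys xs] by (cases "r \<le> s") auto
  qed
  show "(\<lambda>(r, xs). rotate r xs) ` ({..<size M} \<times> ?F) = permutations_of_multiset M"
  proof (intro subset_antisym subsetI)
    fix ys assume "ys \<in> (\<lambda>(r, xs). rotate r xs) ` ({..<size M} \<times> ?F)"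
    then show "ys \<in> permutations_of_multiset M"
      by (auto simp: permutations_of_multiset_def)
  next
    fix ys assume ys: "ys \<in> permutations_of_multiset M"
    have "M \<noteq> {#}" using sum by auto
    then have pos: "size M > 0" by (simp add: nonempty_has_size)
    have "(\<Sum>c\<leftarrow>ys. step c) = - 1"
      using sum ys by (simp add: permutations_of_multiset_def flip: sum_mset_sum_list)
    then obtain r where r: "first_passage 1 (rotate r ys)"
      using first_passage_rotate_exists by blast
    \<comment> \<open>Rotation and inverse are both reduced modulo \<open>size M\<close>; for
      \<open>s = 0\<close> the inverse \<open>size M - s\<close> would be out of range.\<close>
    define s where "s = r mod size M"
    have s: "s < size M" "rotate r ys = rotate s ys"
      using pos len[OF ys] by (auto simp: s_def rotate_conv_mod[of r])
    have "rotate ((size M - s) mod size M) (rotate s ys) = rotate (size M - s) (rotate s ys)"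
      using len[OF ys] by (subst (2) rotate_conv_mod) simp
    also have "\<dots> = ys"
      using s len[OF ys] by (simp add: rotate_rotate)
    finally have "ys = rotate ((size M - s) mod size M) (rotate s ys)" ..
    moreover have "rotate s ys \<in> ?F"
      using ys r s by (simp add: permutations_of_multiset_def)
    ultimately show "ys \<in> (\<lambda>(r, xs). rotate r xs) ` ({..<size M} \<times> ?F)"
      using pos by (intro image_eqI[where x = "((size M - s) mod size M, rotate s ys)"]) auto
  qed
qed

lemma card_trees:
  assumes "(\<Sum>c\<in>#M. step c) = - 1"
  shows "size M * card (forests 1 M) = card (permutations_of_multiset M)"
  using bij_betw_same_card[OF bij_betw_rotate[OF assms]] bij_betw_same_card[OF bij_betw_bfs[of 1 M]]
  by simp

subsection \<open>A maximal inequality for random permutations\<close>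

lemma card_permutations_Cons:
  assumes "M \<noteq> {#}"
  shows "card {xs \<in> permutations_of_multiset M. P xs}
    = (\<Sum>x\<in>set_mset M. card {xs \<in> permutations_of_multiset (M - {#x#}). P (x # xs)})"
proof -
  let ?B = "\<lambda>x. (#) x ` {xs \<in> permutations_of_multiset (M - {#x#}). P (x # xs)}"
  have "{xs \<in> permutations_of_multiset M. P xs} = (\<Union>x\<in>set_mset M. ?B x)"
    using permutations_of_multiset_nonempty[OF assms] by auto
  also have "card \<dots> = (\<Sum>x\<in>set_mset M. card (?B x))"
    by (rule card_UN_disjoint) auto
  also have "\<dots> = (\<Sum>x\<in>set_mset M. card {xs \<in> permutations_of_multiset (M - {#x#}). P (x # xs)})"
    by (intro sum.cong refl card_image) auto
  finally show ?thesis .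
qed

lemma sum_mset_count:
  fixes g :: "'a \<Rightarrow> real"
  assumes "finite A" "set_mset M \<subseteq> A"
  shows "(\<Sum>x\<in>#M. g x) = (\<Sum>x\<in>A. real (count M x) * g x)"
  using assms(2)
proof (induction M)
  case (add a M)
  have "(\<Sum>x\<in>A. real (count (add_mset a M) x) * g x)
    = (\<Sum>x\<in>A. real (count M x) * g x + (if x = a then g x else 0))"
    by (intro sum.cong) (auto simp: algebra_simps)
  then show ?case
    using add assms(1) by (simp add: sum.distrib)
qed simp

text \<open>Averaging over the first entry of a uniform ordering, which equals \<open>x\<close> with
  probability \<open>count M x / size M\<close>.\<close>

lemma sum_perms_remove:
  fixes g :: "'a \<Rightarrow> real"
  shows "(\<Sum>x\<in>set_mset M. card (permutations_of_multiset (M - {#x#})) * g x)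
    = card (permutations_of_multiset M) / size M * (\<Sum>x\<in>#M. g x)"
proof (cases "M = {#}")
  case False
  have "(\<Sum>x\<in>set_mset M. card (permutations_of_multiset (M - {#x#})) * g x)
    = (\<Sum>x\<in>set_mset M. card (permutations_of_multiset M) / size M * (real (count M x) * g x))"
  proof (intro sum.cong refl)
    fix x assume "x \<in># M"
    from real_card_permutations_of_multiset_remove[OF this] False
    show "card (permutations_of_multiset (M - {#x#})) * g x
      = card (permutations_of_multiset M) / size M * (real (count M x) * g x)"
      by (simp add: field_simps)
  qed
  then show ?thesis
    by (simp add: sum_mset_count[of "set_mset M" M g] sum_distrib_left)
qed simp

lemma sum_mset_nonneg:
  fixes f :: "'a \<Rightarrow> real"
  shows "(\<And>x. f x \<ge> 0) \<Longrightarrow> (\<Sum>x\<in>#M. f x) \<ge> 0"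
  by (induction M) auto

lemma sum_mset_shifted_squares:
  fixes f :: "'a \<Rightarrow> real" and Y d b :: real
  shows "(\<Sum>x\<in>#M. ((Y + f x) / d)\<^sup>2 + b)
    = (size M * Y\<^sup>2 + 2 * Y * (\<Sum>x\<in>#M. f x) + (\<Sum>x\<in>#M. (f x)\<^sup>2)) / d\<^sup>2 + size M * b"
proof (induction M)
  case (add x M)
  have "((Y + f x) / d)\<^sup>2 = (Y\<^sup>2 + 2 * Y * f x + (f x)\<^sup>2) / d\<^sup>2"
    by (simp add: power2_eq_square algebra_simps)
  then show ?case
    using add by (simp add: algebra_simps add_divide_distrib)
qed simp

text \<open>With \<open>m\<close> elements left and current value \<open>Y\<close>, the quantity \<open>(Y / m)\<^sup>2\<close> is a submartingale;
  \<open>v * k / real r ^ 3\<close> bounds what it can gain in the next \<open>k\<close> steps.\<close>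

lemma card_permutations_large_bridge:
  fixes f :: "'a \<Rightarrow> real" and Y w :: real and k n r :: nat
  assumes "Y + (\<Sum>x\<in>#M. f x) = 0" "size M = r + k" "r \<ge> 1" "size M \<le> n" "w > 0"
  shows "w\<^sup>2 / (real n)\<^sup>2 * card {xs \<in> permutations_of_multiset M. \<exists>j\<le>k. \<bar>Y + (\<Sum>x\<leftarrow>take j xs. f x)\<bar> \<ge> w}
    \<le> card (permutations_of_multiset M) * ((Y / size M)\<^sup>2 + (\<Sum>x\<in>#M. (f x)\<^sup>2) * k / real r ^ 3)"
  using assms
proof (induction k arbitrary: M Y)
  case 0
  show ?case
  proof (cases "\<bar>Y\<bar> \<ge> w")
    case True
    have "w\<^sup>2 / (real n)\<^sup>2 \<le> Y\<^sup>2 / (real (size M))\<^sup>2"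
      using True 0 by (intro frac_le) (auto simp: abs_le_square_iff[symmetric])
    then have "card (permutations_of_multiset M) * (w\<^sup>2 / (real n)\<^sup>2) \<le> card (permutations_of_multiset M) * (Y\<^sup>2 / (real (size M))\<^sup>2)"
      by (intro mult_left_mono) auto
    then show ?thesis using True by (simp add: power_divide mult.commute)
  qed simp
next
  case (Suc k)
  define p where "p = real (card (permutations_of_multiset M))"
  define v where "v = (\<Sum>x\<in>#M. (f x)\<^sup>2)"
  define m where "m = real (size M)"
  have v: "v \<ge> 0"
    unfolding v_def by (intro sum_mset_nonneg) simp
  show ?case
  \<comment> \<open>If \<open>w\<close> is already reached, the term \<open>(Y / m)^2\<close> alone
    pays for the whole probability, because \<open>m \<le> n\<close>. Otherwise condition on the
    first entry.\<close>
  proof (cases "\<bar>Y\<bar> \<ge> w")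
    case True
    have "w\<^sup>2 / (real n)\<^sup>2 \<le> Y\<^sup>2 / m\<^sup>2"
      using True Suc.prems by (intro frac_le) (auto simp: m_def abs_le_square_iff[symmetric])
    also have "\<dots> \<le> (Y / m)\<^sup>2 + v * Suc k / real r ^ 3"
      using v by (simp add: power_divide)
    finally have le: "w\<^sup>2 / (real n)\<^sup>2 \<le> (Y / m)\<^sup>2 + v * Suc k / real r ^ 3" .
    have "card {xs \<in> permutations_of_multiset M. \<exists>j\<le>Suc k. \<bar>Y + (\<Sum>x\<leftarrow>take j xs. f x)\<bar> \<ge> w}
      \<le> card (permutations_of_multiset M)"
      by (intro card_mono) auto
    then have "w\<^sup>2 / (real n)\<^sup>2 * card {xs \<in> permutations_of_multiset M. \<exists>j\<le>Suc k. \<bar>Y + (\<Sum>x\<leftarrow>take j xs. f x)\<bar> \<ge> w}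
      \<le> w\<^sup>2 / (real n)\<^sup>2 * p"
      unfolding p_def by (intro mult_left_mono) auto
    also have "\<dots> \<le> ((Y / m)\<^sup>2 + v * Suc k / real r ^ 3) * p"
      using le by (intro mult_right_mono) (auto simp: p_def)
    also have "\<dots> = p * ((Y / m)\<^sup>2 + v * Suc k / real r ^ 3)"
      by (rule mult.commute)
    finally show ?thesis by (simp only: p_def v_def m_def)
  next
    case False
    have M: "M \<noteq> {#}" using Suc.prems by auto
    define E where "E x = {xs \<in> permutations_of_multiset (M - {#x#}). \<exists>j\<le>k. \<bar>Y + f x + (\<Sum>x\<leftarrow>take j xs. f x)\<bar> \<ge> w}" for x
    define g where "g x = ((Y + f x) / (m - 1))\<^sup>2 + v * k / real r ^ 3" for x
    have bound: "w\<^sup>2 / (real n)\<^sup>2 * card (E x) \<le> card (permutations_of_multiset (M - {#x#})) * g x" if x: "x \<in># M" for x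
    proof -
      obtain M' where M': "M = add_mset x M'" using x by (blast dest: multi_member_split)
      have "w\<^sup>2 / (real n)\<^sup>2 * card (E x) \<le> card (permutations_of_multiset (M - {#x#})) *
          (((Y + f x) / size (M - {#x#}))\<^sup>2 + (\<Sum>x\<in>#M - {#x#}. (f x)\<^sup>2) * k / real r ^ 3)"
        unfolding E_def by (rule Suc.IH) (use Suc.prems M' in auto)
      also have "\<dots> \<le> card (permutations_of_multiset (M - {#x#})) * g x"
        unfolding g_def using v
        by (intro mult_left_mono add_mono divide_right_mono mult_right_mono) (auto simp: m_def v_def M')
      finally show ?thesis .
    qed
    have "(\<exists>j\<le>Suc k. w \<le> \<bar>Y + (\<Sum>x\<leftarrow>take j (x # xs). f x)\<bar>)
        \<longleftrightarrow> (\<exists>j\<le>k. w \<le> \<bar>Y + f x + (\<Sum>x\<leftarrow>take j xs. f x)\<bar>)" for x xs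
    proof -
      have "(\<exists>j\<le>Suc k. P j) \<longleftrightarrow> P 0 \<or> (\<exists>j\<le>k. P (Suc j))" for P
        by (metis le0 Suc_le_mono not0_implies_Suc)
      then show ?thesis using False by (simp add: add.assoc)
    qed
    then have "w\<^sup>2 / (real n)\<^sup>2 * card {xs \<in> permutations_of_multiset M. \<exists>j\<le>Suc k. \<bar>Y + (\<Sum>x\<leftarrow>take j xs. f x)\<bar> \<ge> w}
      = (\<Sum>x\<in>set_mset M. w\<^sup>2 / (real n)\<^sup>2 * card (E x))"
      by (simp add: card_permutations_Cons[OF M] E_def sum_distrib_left)
    also have "\<dots> \<le> (\<Sum>x\<in>set_mset M. card (permutations_of_multiset (M - {#x#})) * g x)"
      by (intro sum_mono bound)
    also have "\<dots> = p / m * (\<Sum>x\<in>#M. g x)"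
      by (simp add: sum_perms_remove p_def m_def)
    \<comment> \<open>The remaining values sum to \<open>- Y\<close>, which turns the cross term
      into \<open>- 2 * Y^2\<close>.\<close>
    also have "(\<Sum>x\<in>#M. g x) = (m * Y\<^sup>2 + 2 * Y * (- Y) + v) / (m - 1)\<^sup>2 + m * (v * k / real r ^ 3)"
    proof -
      have "(\<Sum>x\<in>#M. f x) = - Y" using Suc.prems by simp
      then show ?thesis
        using sum_mset_shifted_squares[where Y = Y and f = f and d = "m - 1" and b = "v * k / real r ^ 3" and M = M]
        by (simp only: g_def m_def v_def)
    qed
    also have "p / m * \<dots> \<le> p * ((Y / m)\<^sup>2 + v * Suc k / real r ^ 3)"
    proof -
      have m: "m - 1 \<ge> r" "real r \<ge> 1" using Suc.prems by (auto simp: m_def)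
      have "(m * Y\<^sup>2 + 2 * Y * (- Y) + v) / (m - 1)\<^sup>2 / m
        = Y\<^sup>2 * (m - 2) / (m * (m - 1)\<^sup>2) + v / (m * (m - 1)\<^sup>2)"
        by (simp add: field_simps power2_eq_square add_divide_distrib diff_divide_distrib)
      \<comment> \<open>Because \<open>m * (m - 2) \<le> (m - 1)^2\<close>. Thus one step adds only
        the variance term, bounded next.\<close>
      also have "Y\<^sup>2 * (m - 2) / (m * (m - 1)\<^sup>2) \<le> (Y / m)\<^sup>2"
      proof -
        have "(m - 2) / (m * (m - 1)\<^sup>2) \<le> 1 / m\<^sup>2"
          using m by (simp add: divide_simps) (simp add: power2_eq_square algebra_simps)
        then have "Y\<^sup>2 * ((m - 2) / (m * (m - 1)\<^sup>2)) \<le> Y\<^sup>2 * (1 / m\<^sup>2)"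
          by (intro mult_left_mono) auto
        then show ?thesis by (simp add: power_divide)
      qed
      also have "v / (m * (m - 1)\<^sup>2) \<le> v / real r ^ 3"
      proof -
        have "real r ^ 3 = real r * (real r)\<^sup>2" by (simp add: power3_eq_cube power2_eq_square)
        also have "\<dots> \<le> m * (m - 1)\<^sup>2"
          using m by (intro mult_mono power_mono) auto
        finally show ?thesis using v m by (intro divide_left_mono) auto
      qed
      finally have "(m * Y\<^sup>2 + 2 * Y * (- Y) + v) / (m - 1)\<^sup>2 / m + v * k / real r ^ 3
        \<le> (Y / m)\<^sup>2 + v * Suc k / real r ^ 3"
        by (simp add: algebra_simps add_divide_distrib)
      then have "p * ((m * Y\<^sup>2 + 2 * Y * (- Y) + v) / (m - 1)\<^sup>2 / m + v * k / real r ^ 3)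
        \<le> p * ((Y / m)\<^sup>2 + v * Suc k / real r ^ 3)"
        by (intro mult_left_mono) (auto simp: p_def)
      moreover have "p / m * (A + m * B) = p * (A / m + B)" for A B
        using m by (simp add: field_simps)
      ultimately show ?thesis by (simp only:)
    qed
    finally show ?thesis by (simp only: p_def v_def m_def)
  qed
qed

text \<open>The second half of a permutation is the first half of its reversal.\<close>

lemma card_permutations_large_partial_sum:
  fixes f :: "'a \<Rightarrow> real" and u :: real
  assumes sum: "(\<Sum>x\<in>#M. f x) = - 1" and "size M \<ge> 2" and u: "u > 1"
  shows "(u - 1)\<^sup>2 * card {xs \<in> permutations_of_multiset M. \<exists>j\<le>size M. \<bar>\<Sum>x\<leftarrow>take j xs. f x\<bar> \<ge> u}
    \<le> 2 * (1 + 4 * (\<Sum>x\<in>#M. (f x)\<^sup>2)) * card (permutations_of_multiset M)"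
proof -
  \<comment> \<open>\<open>r\<close> is the larger half, so \<open>k \<le> r\<close> and
    \<open>n \<le> 2 * r\<close>; this gives the factor 4 below.\<close>
  define n k r where "n = size M" and "k = n div 2" and "r = n - n div 2"
  define p where "p = real (card (permutations_of_multiset M))"
  define v where "v = (\<Sum>x\<in>#M. (f x)\<^sup>2)"
  \<comment> \<open>Starting from 1 turns the total - 1 into the total 0 of a bridge, at the cost of
    the 1 in \<open>u - 1\<close>.\<close>
  define H where "H = {xs \<in> permutations_of_multiset M. \<exists>j\<le>k. \<bar>1 + (\<Sum>x\<leftarrow>take j xs. f x)\<bar> \<ge> u - 1}"
  define B where "B = {xs \<in> permutations_of_multiset M. \<exists>j\<le>n. \<bar>\<Sum>x\<leftarrow>take j xs. f x\<bar> \<ge> u}"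
  have v: "v \<ge> 0"
    unfolding v_def by (intro sum_mset_nonneg) simp
  have r: "r \<ge> 1" "n = r + k" "k \<le> r" "n \<le> 2 * r"
    using assms by (auto simp: r_def k_def n_def)
  have n: "real n > 0" using r by simp
  have "(u - 1)\<^sup>2 / (real n)\<^sup>2 * card H \<le> p * ((1 / n)\<^sup>2 + v * k / real r ^ 3)"
    unfolding H_def p_def v_def n_def
    by (rule card_permutations_large_bridge) (use assms r in \<open>auto simp: n_def\<close>)
  then have "(real n)\<^sup>2 * ((u - 1)\<^sup>2 / (real n)\<^sup>2 * card H) \<le> (real n)\<^sup>2 * (p * ((1 / n)\<^sup>2 + v * k / real r ^ 3))"
    by (intro mult_left_mono) auto
  also have "(real n)\<^sup>2 * ((u - 1)\<^sup>2 / (real n)\<^sup>2 * card H) = (u - 1)\<^sup>2 * card H"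
    using n by simp
  also have "(real n)\<^sup>2 * (p * ((1 / n)\<^sup>2 + v * k / real r ^ 3)) = p * (1 + v * ((real n)\<^sup>2 * k / real r ^ 3))"
    using n r by (simp add: field_simps)
  also have "\<dots> \<le> p * (1 + v * 4)"
  proof -
    have "(real n)\<^sup>2 * k \<le> (2 * real r)\<^sup>2 * real r"
      using r by (intro mult_mono power_mono) auto
    then have "(real n)\<^sup>2 * k / real r ^ 3 \<le> 4"
      using r by (simp add: divide_simps) (simp add: power3_eq_cube power2_eq_square)
    then show ?thesis
      using v by (intro mult_left_mono add_left_mono) (auto simp: p_def)
  qed
  finally have H: "(u - 1)\<^sup>2 * card H \<le> p * (1 + v * 4)" .
  have "B \<subseteq> H \<union> rev ` H"
  proof
    fix xs assume "xs \<in> B"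
    then obtain j where j: "j \<le> n" "\<bar>\<Sum>x\<leftarrow>take j xs. f x\<bar> \<ge> u" and xs: "xs \<in> permutations_of_multiset M"
      by (auto simp: B_def)
    show "xs \<in> H \<union> rev ` H"
    proof (cases "j \<le> k")
      case True
      then show ?thesis using j xs by (force simp: H_def)
    next
      case False
      have len: "length xs = n" and total: "(\<Sum>x\<leftarrow>xs. f x) = - 1"
        using xs sum by (auto simp: permutations_of_multiset_def n_def simp flip: sum_mset_sum_list)
      have "(\<Sum>x\<leftarrow>xs. f x) = (\<Sum>x\<leftarrow>take j xs. f x) + (\<Sum>x\<leftarrow>drop j xs. f x)"
        by (simp flip: sum_list_append map_append)
      moreover have "(\<Sum>x\<leftarrow>take (n - j) (rev xs). f x) = (\<Sum>x\<leftarrow>drop j xs. f x)"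
        using j len by (simp add: take_rev rev_map[symmetric])
      ultimately have "\<bar>1 + (\<Sum>x\<leftarrow>take (n - j) (rev xs). f x)\<bar> \<ge> u - 1"
        using j total by simp
      moreover have "n - j \<le> k" using False by (simp add: k_def)
      ultimately have "rev xs \<in> H"
        using xs by (auto simp: H_def permutations_of_multiset_def)
      then show ?thesis by (metis UnI2 image_eqI rev_rev_ident)
    qed
  qed
  moreover have "finite H" by (simp add: H_def)
  ultimately have "card B \<le> card (H \<union> rev ` H)"
    by (intro card_mono) auto
  also have "\<dots> \<le> card H + card (rev ` H)" by (rule card_Un_le)
  also have "card (rev ` H) = card H" by (intro card_image) simp
  finally have "real (card B) \<le> 2 * card H" by linarith
  then have "(u - 1)\<^sup>2 * card B \<le> (u - 1)\<^sup>2 * (2 * card H)"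
    by (intro mult_left_mono) auto
  also have "\<dots> \<le> 2 * (1 + 4 * v) * p"
    using H by (simp add: algebra_simps)
  finally show ?thesis by (simp only: B_def v_def p_def n_def)
qed

subsection \<open>The width\<close>

text \<open>Up to the total - 1, a partial sum of \<open>xs\<close> is a difference of two partial
  sums of the rotated list; were these both below \<open>u\<close> in absolute value, it would be
  below \<open>2 * u + 1\<close>.\<close>

lemma large_partial_sum_rotate:
  fixes f :: "'a \<Rightarrow> real" and u :: real
  assumes total: "(\<Sum>x\<leftarrow>xs. f x) = - 1"
    and j: "j \<le> length xs" "\<bar>\<Sum>x\<leftarrow>take j xs. f x\<bar> \<ge> 2 * u + 1"
  shows "\<exists>i\<le>length xs. \<bar>\<Sum>x\<leftarrow>take i (rotate r xs). f x\<bar> \<ge> u"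
proof (rule ccontr)
  define us vs where "us = take (r mod length xs) xs" and "vs = drop (r mod length xs) xs"
  have xs: "xs = us @ vs" and rot: "rotate r xs = vs @ us"
    by (auto simp: us_def vs_def rotate_drop_take)
  assume "\<not> ?thesis"
  then have small: "\<bar>\<Sum>x\<leftarrow>take i (vs @ us). f x\<bar> < u" if "i \<le> length us + length vs" for i
    using that unfolding rot by (metis length_append not_le xs)
  have vs: "\<bar>\<Sum>x\<leftarrow>vs. f x\<bar> < u" using small[of "length vs"] by simp
  have sum: "(\<Sum>x\<leftarrow>us. f x) + (\<Sum>x\<leftarrow>vs. f x) = - 1" using total by (simp add: xs)
  show False
  proof (cases "j \<le> length us")
    case True
    then show False using small[of "length vs + j"] vs j(2) by (simp add: xs)
  next
    case False
    have "j - length us \<le> length us + length vs" "j - length us - length vs = 0"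
      using j(1) by (auto simp: xs)
    then have "\<bar>\<Sum>x\<leftarrow>take (j - length us) vs. f x\<bar> < u"
      using small[of "j - length us"] by simp
    moreover have "(\<Sum>x\<leftarrow>take j xs. f x) = (\<Sum>x\<leftarrow>us. f x) + (\<Sum>x\<leftarrow>take (j - length us) vs. f x)"
      using False by (simp add: xs)
    ultimately show False using vs sum j(2) by linarith
  qed
qed

definition deg_trees :: "nat multiset \<Rightarrow> plane_tree set" where
  "deg_trees M = {t. degs t = M}"

lemma bij_betw_deg_trees: "bij_betw (\<lambda>t. [t]) (deg_trees M) (forests 1 M)"
  by (rule bij_betw_imageI) (auto simp: deg_trees_def forests_def inj_on_def length_Suc_conv)

text \<open>The rotations of the codes of wide trees are distinct orderings with a large partial
  sum, so there are at least \<open>size M\<close> such orderings per wide tree, and the maximal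
  inequality applies.\<close>

lemma card_wide_trees:
  fixes w :: real
  assumes sum: "(\<Sum>c\<in>#M. step c) = - 1" and M: "size M \<ge> 2" and w: "w > 4"
  shows "(w - 4)\<^sup>2 * card {t \<in> deg_trees M. real (tree_width t) \<ge> w}
    \<le> 8 * (1 + 4 * (\<Sum>c\<in>#M. (step c)\<^sup>2)) * card (deg_trees M)"
proof -
  \<comment> \<open>Chosen so that \<open>2 * u + 1 = w - 1\<close>: a level size exceeds its
    partial sum by the initial queue length 1.\<close>
  define u where "u = (w - 2) / 2"
  define n where "n = size M"
  define A where "A = {t \<in> deg_trees M. real (tree_width t) \<ge> w}"
  define B where "B = {xs \<in> permutations_of_multiset M. \<exists>j\<le>n. \<bar>\<Sum>c\<leftarrow>take j xs. step c\<bar> \<ge> u}"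
  define F where "F = {xs \<in> permutations_of_multiset M. first_passage 1 xs}"
  have bfs: "bfs [t] \<in> F" if "t \<in> deg_trees M" for t
    using that mset_bfs[of "[t]"] first_passage_bfs[of "[t]"]
    by (simp add: F_def deg_trees_def permutations_of_multiset_def)
  have "(\<lambda>(r, t). rotate r (bfs [t])) ` ({..<n} \<times> A) \<subseteq> B"
  proof clarify
    fix r t assume "r < n" and "t \<in> A"
    then have t: "t \<in> deg_trees M" "real (tree_width t) \<ge> w" by (auto simp: A_def)
    define xs where "xs = bfs [t]"
    have xs: "mset xs = M" "length xs = n" "(\<Sum>c\<leftarrow>xs. step c) = - 1"
      using bfs[OF t(1)] sum
      by (auto simp: F_def xs_def n_def permutations_of_multiset_def simp flip: sum_mset_sum_list)
    obtain h where h: "tree_width t = level_size h t" using tree_width_eq by blast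
    obtain j where j: "j \<le> length xs" "int (level_size h t) = 1 + (\<Sum>c\<leftarrow>take j xs. int c - 1)"
      using level_size_queue[of "[t]" h] by (auto simp: xs_def)
    have "of_int (\<Sum>c\<leftarrow>ys. int c - 1) = (\<Sum>c\<leftarrow>ys. step c)" for ys
      by (induction ys) auto
    then have "real (level_size h t) = 1 + (\<Sum>c\<leftarrow>take j xs. step c)"
      using arg_cong[OF j(2), of real_of_int] by simp
    then have "\<bar>\<Sum>c\<leftarrow>take j xs. step c\<bar> \<ge> 2 * u + 1"
      using t(2) h w by (simp add: u_def field_simps)
    then have "\<exists>i\<le>length xs. \<bar>\<Sum>c\<leftarrow>take i (rotate r xs). step c\<bar> \<ge> u"
      using large_partial_sum_rotate xs(3) j(1) by blast
    then show "rotate r (bfs [t]) \<in> B"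
      using xs unfolding xs_def[symmetric] by (simp add: B_def permutations_of_multiset_def)
  qed
  moreover have "inj_on (\<lambda>(r, t). rotate r (bfs [t])) ({..<n} \<times> A)"
  proof (rule inj_onI, clarify)
    fix r t r' t'
    assume *: "r < n" "r' < n" "t \<in> A" "t' \<in> A" "rotate r (bfs [t]) = rotate r' (bfs [t'])"
    have "inj_on (\<lambda>(r, xs). rotate r xs) ({..<n} \<times> F)"
      using bij_betw_rotate[OF sum] by (simp add: bij_betw_def n_def F_def)
    then have "(r, bfs [t]) = (r', bfs [t'])"
      by (rule inj_onD) (use * bfs in \<open>auto simp: A_def\<close>)
    then show "r = r' \<and> t = t'" using bfs_inject[of "[t]" "[t']"] by simp
  qed
  moreover have "finite B" by (simp add: B_def)
  ultimately have "card ({..<n} \<times> A) \<le> card B"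
    by (intro card_inj_on_le)
  then have "n * card A \<le> card B" by (simp add: card_cartesian_product)
  then have "real n * card A \<le> card B" by (metis of_nat_le_iff of_nat_mult)
  then have "(u - 1)\<^sup>2 * (real n * card A) \<le> (u - 1)\<^sup>2 * card B"
    by (intro mult_left_mono) auto
  also have "\<dots> \<le> 2 * (1 + 4 * (\<Sum>c\<in>#M. (step c)\<^sup>2)) * card (permutations_of_multiset M)"
    unfolding B_def n_def
    by (rule card_permutations_large_partial_sum) (use assms in \<open>auto simp: u_def\<close>)
  also have "real (card (permutations_of_multiset M)) = n * card (deg_trees M)"
    using card_trees[OF sum] bij_betw_same_card[OF bij_betw_deg_trees[of M]]
    by (simp add: n_def flip: of_nat_mult)
  finally have "real n * ((u - 1)\<^sup>2 * card A)
      \<le> real n * (2 * (1 + 4 * (\<Sum>c\<in>#M. (step c)\<^sup>2)) * card (deg_trees M))"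
    by (simp add: algebra_simps)
  then have "(u - 1)\<^sup>2 * card A \<le> 2 * (1 + 4 * (\<Sum>c\<in>#M. (step c)\<^sup>2)) * card (deg_trees M)"
    using M by (simp add: n_def)
  then have "4 * ((u - 1)\<^sup>2 * card A) \<le> 4 * (2 * (1 + 4 * (\<Sum>c\<in>#M. (step c)\<^sup>2)) * card (deg_trees M))"
    by (rule mult_left_mono) simp
  also have "4 * ((u - 1)\<^sup>2 * card A) = (w - 4)\<^sup>2 * card A"
    by (simp add: u_def power2_eq_square field_simps)
  also have "4 * (2 * (1 + 4 * (\<Sum>c\<in>#M. (step c)\<^sup>2)) * card (deg_trees M))
    = 8 * (1 + 4 * (\<Sum>c\<in>#M. (step c)\<^sup>2)) * card (deg_trees M)"
    by (simp add: algebra_simps)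
  finally show ?thesis by (simp only: A_def)
qed

subsection \<open>Elementary symmetric polynomials of a multiset\<close>

text \<open>Its coefficients are the elementary symmetric polynomials of the entries. Evaluation
  will bound them, and differentiation describes the removal of an entry.\<close>

definition esym_poly :: "nat multiset \<Rightarrow> real poly" where
  "esym_poly M = (\<Prod>d\<in>#M. [:1, real d:])"

definition esym :: "nat multiset \<Rightarrow> nat \<Rightarrow> real" where
  "esym M h = coeff (esym_poly M) h"

lemma esym_poly_add [simp]: "esym_poly (add_mset d M) = [:1, real d:] * esym_poly M"
  by (simp add: esym_poly_def)

lemma esym_0 [simp]: "esym M 0 = 1"
proof -
  have "poly (esym_poly M) 0 = 1" by (induction M) (simp_all add: esym_poly_def)
  then show ?thesis by (simp add: esym_def poly_0_coeff_0)
qed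

lemma esym_nonneg: "esym M h \<ge> 0"
proof (induction M arbitrary: h)
  case empty
  then show ?case by (simp add: esym_def esym_poly_def)
next
  case (add d M)
  then show ?case by (cases h) (auto simp: esym_def)
qed

text \<open>The coefficients are nonnegative, so a single term is at most the value at
  \<open>z\<close>.\<close>

lemma esym_power_le:
  fixes z :: real
  assumes "z \<ge> 0"
  shows "esym M h * z ^ h \<le> (\<Prod>d\<in>#M. 1 + d * z)"
proof -
  have "poly (esym_poly M) z = (\<Prod>d\<in>#M. 1 + d * z)"
    by (induction M) (simp_all add: esym_poly_def algebra_simps)
  moreover have "esym M h * z ^ h \<le> poly (esym_poly M) z"
  proof (cases "h \<le> degree (esym_poly M)")
    case True
    then have "esym M h * z ^ h \<le> (\<Sum>i\<le>degree (esym_poly M). esym M i * z ^ i)"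
      using assms by (intro member_le_sum) (auto simp: esym_nonneg)
    then show ?thesis by (simp add: poly_altdef esym_def)
  next
    case False
    have "0 \<le> (\<Sum>i\<le>degree (esym_poly M). esym M i * z ^ i)"
      using assms by (intro sum_nonneg) (auto simp: esym_nonneg)
    then show ?thesis using False by (simp add: poly_altdef esym_def coeff_eq_0)
  qed
  ultimately show ?thesis by simp
qed

lemma pderiv_esym_poly: "pderiv (esym_poly M) = (\<Sum>d\<in>#M. smult (real d) (esym_poly (M - {#d#})))"
proof (induction M)
  case empty
  then show ?case by (simp add: esym_poly_def)
next
  case (add x M)
  have "(\<Sum>d\<in>#M. smult (real d) (esym_poly (add_mset x M - {#d#})))
    = (\<Sum>d\<in>#M. [:1, real x:] * smult (real d) (esym_poly (M - {#d#})))"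
  proof (intro arg_cong[of _ _ sum_mset] image_mset_cong)
    fix d assume "d \<in># M"
    then have "add_mset x M - {#d#} = add_mset x (M - {#d#})" by auto
    then show "smult (real d) (esym_poly (add_mset x M - {#d#})) = [:1, real x:] * smult (real d) (esym_poly (M - {#d#}))"
      by (simp only: esym_poly_add mult_smult_right)
  qed
  also have "\<dots> = [:1, real x:] * pderiv (esym_poly M)"
    by (simp only: add sum_mset_distrib_left)
  finally show ?case
    by (simp add: pderiv_mult pderiv_pCons add.commute del: mult_pCons_left)
qed

text \<open>Coefficients in the product rule; combinatorially, each product of \<open>h + 1\<close>
  entries is counted once for each of its factors.\<close>

lemma sum_esym_remove: "(\<Sum>d\<in>#M. d * esym (M - {#d#}) h) = Suc h * esym M (Suc h)"
proof -
  have "coeff (\<Sum>d\<in>#A. p d) h = (\<Sum>d\<in>#A. coeff (p d) h)" for A :: "nat multiset" and p :: "nat \<Rightarrow> real poly"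
    by (induction A) auto
  then have "(\<Sum>d\<in>#M. d * esym (M - {#d#}) h) = coeff (pderiv (esym_poly M)) h"
    by (simp add: pderiv_esym_poly esym_def)
  then show ?thesis by (simp add: coeff_pderiv esym_def)
qed

subsection \<open>The height\<close>

lemma finite_deg_trees: "finite (deg_trees M)"
  using bij_betw_finite[OF bij_betw_deg_trees[of M]] finite_forests by simp

lemma forest_degs_swap:
  assumes "i < length ts" "j < length ts"
  shows "forest_degs (ts[i := ts ! j, j := ts ! i]) = forest_degs ts"
proof -
  have "forest_degs us = (\<Sum>t\<in>#mset us. degs t)" for us :: "plane_tree list"
    by (simp flip: sum_mset_sum_list)
  then show ?thesis by (simp only: mset_swap[OF assms(2,1)])
qed

text \<open>Exchanging the trees at positions 0 and \<open>i\<close> is an involution on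
  \<open>forests k M\<close>.\<close>

lemma sum_forests_nth:
  fixes g :: "plane_tree \<Rightarrow> real"
  assumes "i < k"
  shows "(\<Sum>ts\<in>forests k M. g (ts ! i)) = (\<Sum>ts\<in>forests k M. g (ts ! 0))"
proof -
  define s where "s ts = ts[0 := ts ! i, i := ts ! 0]" for ts :: "plane_tree list"
  have s: "s ts \<in> forests k M" "s (s ts) = ts" "s ts ! 0 = ts ! i" if "ts \<in> forests k M" for ts
  proof -
    have ts: "length ts = k" "ts \<noteq> []" "i < length ts"
      using that assms by (auto simp: forests_def)
    then show "s ts \<in> forests k M"
      using that forest_degs_swap[of 0 ts i] by (auto simp: s_def forests_def)
    show "s (s ts) = ts"
      using ts by (intro nth_equalityI) (auto simp: s_def nth_list_update)
    show "s ts ! 0 = ts ! i"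
      using ts by (auto simp: s_def nth_list_update)
  qed
  have "s ts ! i = ts ! 0" if "ts \<in> forests k M" for ts
    using s[OF that] s(3)[of "s ts"] by simp
  then show ?thesis
    using s by (intro sum.reindex_bij_witness[of _ s s]) auto
qed

text \<open>Remove the root of the first tree; by symmetry, each of its \<open>c\<close> subtrees may be assumed to come first.\<close>

lemma sum_forests_Suc:
  "(\<Sum>ts\<in>forests (Suc k) M. real (level_size (Suc h) (ts ! 0)))
    = (\<Sum>c\<in>set_mset M. c * (\<Sum>us\<in>forests (c + k) (M - {#c#}). real (level_size h (us ! 0))))"
proof -
  \<comment> \<open>\<open>join\<close> undoes the removal of the first root, whose children are
    kept as the first \<open>c\<close> trees of the forest.\<close>
  define join where "join = (\<lambda>(c, us). Node (take c us) # drop c us)"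
  define S where "S = (SIGMA c : set_mset M. forests (c + k) (M - {#c#}))"
  have bij: "bij_betw join S (forests (Suc k) M)"
  proof (rule bij_betw_imageI)
    show "inj_on join S"
    proof (rule inj_onI)
      fix x y assume *: "x \<in> S" "y \<in> S" "join x = join y"
      obtain c us d vs where xy: "x = (c, us)" "y = (d, vs)" by (cases x; cases y)
      have tk: "take c us = take d vs" "drop c us = drop d vs"
        using * by (auto simp: join_def xy)
      then have "us = vs" by (metis append_take_drop_id)
      moreover have "c = length (take c us)" "d = length (take d vs)"
        using * by (auto simp: S_def xy forests_def)
      ultimately show "x = y" using tk xy by metis
    qed
    show "join ` S = forests (Suc k) M"
    proof (intro subset_antisym subsetI)
      fix ts assume "ts \<in> join ` S"
      then obtain c us where us: "c \<in># M" "us \<in> forests (c + k) (M - {#c#})" "ts = Node (take c us) # drop c us"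
        by (auto simp: join_def S_def)
      have "forest_degs us = forest_degs (take c us) + forest_degs (drop c us)"
        by (metis append_take_drop_id map_append sum_list_append)
      then show "ts \<in> forests (Suc k) M"
        using us by (auto simp: forests_def min_def)
    next
      fix ts assume "ts \<in> forests (Suc k) M"
      then obtain t ts' where ts: "ts = t # ts'" "length ts' = k" "degs t + forest_degs ts' = M"
        by (auto simp: forests_def length_Suc_conv)
      obtain cs where t: "t = Node cs" by (cases t)
      show "ts \<in> join ` S"
        using ts t by (intro image_eqI[of _ _ "(length cs, cs @ ts')"]) (auto simp: join_def S_def forests_def)
    qed
  qed
  have "(\<Sum>ts\<in>forests (Suc k) M. real (level_size (Suc h) (ts ! 0)))
    = (\<Sum>x\<in>S. real (level_size (Suc h) (join x ! 0)))"
    by (rule sum.reindex_bij_betw[OF bij, symmetric])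
  also have "\<dots> = (\<Sum>(c, us)\<in>S. \<Sum>i<c. real (level_size h (us ! i)))"
  proof (intro sum.cong refl, clarify)
    fix c us assume "(c, us) \<in> S"
    then have "length us = c + k" by (simp add: S_def forests_def)
    then show "real (level_size (Suc h) (join (c, us) ! 0)) = (\<Sum>i<c. real (level_size h (us ! i)))"
      by (simp add: join_def level_size_Suc sum_list_sum_nth atLeast0LessThan min_def)
  qed
  also have "\<dots> = (\<Sum>c\<in>set_mset M. \<Sum>us\<in>forests (c + k) (M - {#c#}). \<Sum>i<c. real (level_size h (us ! i)))"
    unfolding S_def by (rule sum.Sigma[symmetric]) (auto simp: finite_forests)
  also have "\<dots> = (\<Sum>c\<in>set_mset M. \<Sum>i<c. \<Sum>us\<in>forests (c + k) (M - {#c#}). real (level_size h (us ! i)))"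
    by (intro sum.cong refl sum.swap)
  also have "\<dots> = (\<Sum>c\<in>set_mset M. \<Sum>i<c. \<Sum>us\<in>forests (c + k) (M - {#c#}). real (level_size h (us ! 0)))"
    by (intro sum.cong refl sum_forests_nth) auto
  finally show ?thesis by simp
qed

text \<open>The bound does not depend on \<open>k\<close>, so the induction can pass to the
  \<open>c + k\<close> trees left after removing a root. Summation over the removed degree produces
  the next \<open>esym\<close>.\<close>

lemma sum_level_size_forests_le:
  "(\<Sum>ts\<in>forests (Suc k) M. real (level_size h (ts ! 0)))
    \<le> card (permutations_of_multiset M) * (esym M h / (size M choose h))"
proof (induction h arbitrary: k M)
  case 0
  then show ?case by (simp add: card_forests_le)
next
  case (Suc h)
  define p where "p = real (card (permutations_of_multiset M))"
  define P where "P c = card (permutations_of_multiset (M - {#c#}))" for c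
  have "(\<Sum>ts\<in>forests (Suc k) M. real (level_size (Suc h) (ts ! 0)))
    = (\<Sum>c\<in>set_mset M. c * (\<Sum>us\<in>forests (c + k) (M - {#c#}). real (level_size h (us ! 0))))"
    by (rule sum_forests_Suc)
  also have "\<dots> \<le> (\<Sum>c\<in>set_mset M. P c * (c * esym (M - {#c#}) h / (size M - 1 choose h)))"
  proof (rule sum_mono)
    fix c assume c: "c \<in># M"
    show "c * (\<Sum>us\<in>forests (c + k) (M - {#c#}). real (level_size h (us ! 0)))
      \<le> P c * (c * esym (M - {#c#}) h / (size M - 1 choose h))"
    \<comment> \<open>For \<open>c = 0\<close> both sides vanish; otherwise \<open>c + k\<close> is
      a successor, as the induction hypothesis requires.\<close>
    proof (cases c)
      case (Suc c')
      have "c * (\<Sum>us\<in>forests (c + k) (M - {#c#}). real (level_size h (us ! 0)))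
        \<le> c * (P c * (esym (M - {#c#}) h / (size (M - {#c#}) choose h)))"
        using Suc.IH[of "c' + k" "M - {#c#}"] unfolding P_def Suc by (intro mult_left_mono) simp_all
      then show ?thesis using c by (simp add: size_Diff_singleton mult.left_commute)
    qed simp
  qed
  also have "\<dots> = p / size M * (\<Sum>c\<in>#M. c * esym (M - {#c#}) h / (size M - 1 choose h))"
    unfolding P_def p_def by (rule sum_perms_remove)
  also have "(\<Sum>c\<in>#M. c * esym (M - {#c#}) h / (size M - 1 choose h))
    = Suc h * esym M (Suc h) / (size M - 1 choose h)"
    by (simp only: divide_inverse sum_mset_distrib_right[symmetric] sum_esym_remove)
  also have "p / size M * \<dots> = p * (esym M (Suc h) / (size M choose Suc h))"
  proof (cases "size M")
    case 0
    then show ?thesis by simp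
  next
    case (Suc m)
    then have "Suc h * (size M choose Suc h) = size M * (size M - 1 choose h)"
      using Suc_times_binomial[of h m] by simp
    then have eq: "real (Suc h) * (size M choose Suc h) = size M * (size M - 1 choose h)"
      by (metis of_nat_mult)
    have "p / size M * (Suc h * esym M (Suc h) / (size M - 1 choose h))
      = p * (Suc h * esym M (Suc h)) / (size M * (size M - 1 choose h))"
      by simp
    also have "\<dots> = p * (esym M (Suc h) / (size M choose Suc h))"
      unfolding eq[symmetric] by simp
    finally show ?thesis .
  qed
  finally show ?case by (simp only: p_def)
qed

text \<open>First moment bound: a tree of height at least \<open>h\<close> has a vertex on level
  \<open>h\<close>. The factor \<open>size M\<close> comes from converting orderings into trees by
  the cycle lemma.\<close>

lemma card_high_trees:
  assumes sum: "(\<Sum>c\<in>#M. step c) = - 1"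
  shows "card {t \<in> deg_trees M. tree_height t \<ge> h} \<le> size M * (esym M h / (size M choose h)) * card (deg_trees M)"
proof -
  have "real (card {t \<in> deg_trees M. tree_height t \<ge> h}) = (\<Sum>t\<in>{t \<in> deg_trees M. tree_height t \<ge> h}. 1)"
    by simp
  also have "\<dots> \<le> (\<Sum>t\<in>{t \<in> deg_trees M. tree_height t \<ge> h}. real (level_size h t))"
  proof (rule sum_mono)
    fix t assume "t \<in> {t \<in> deg_trees M. tree_height t \<ge> h}"
    then have "level_size h t > 0" by (intro level_size_pos) simp
    then show "1 \<le> real (level_size h t)" by linarith
  qed
  also have "\<dots> \<le> (\<Sum>t\<in>deg_trees M. real (level_size h t))"
    by (intro sum_mono2 finite_deg_trees) auto
  also have "\<dots> = (\<Sum>ts\<in>forests 1 M. real (level_size h (ts ! 0)))"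
    using sum.reindex_bij_betw[OF bij_betw_deg_trees[of M], of "\<lambda>ts. real (level_size h (ts ! 0))"] by simp
  also have "\<dots> \<le> card (permutations_of_multiset M) * (esym M h / (size M choose h))"
    using sum_level_size_forests_le[where k = 0 and M = M and h = h] by simp
  also have "real (card (permutations_of_multiset M)) = size M * card (deg_trees M)"
    using card_trees[OF sum] bij_betw_same_card[OF bij_betw_deg_trees[of M]]
    by (simp flip: of_nat_mult)
  finally show ?thesis by (simp add: mult_ac)
qed

section \<open>Tail estimate for the elementary symmetric polynomials\<close>

text \<open>\<open>z\<close> is the odds for success probability \<open>h / m\<close>, where
  \<open>h\<close> is a mode of the binomial distribution. The factor from one term to the next,
  \<open>(m - k) * z / (k + 1)\<close>, is at least 1 for \<open>k < h\<close> and at most 1 from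
  \<open>h\<close> on.\<close>

lemma binomial_term_le_mode:
  fixes z :: real
  assumes "h < m"
  defines "z \<equiv> real h / (real m - real h)"
  shows "(m choose k) * z ^ k \<le> (m choose h) * z ^ h"
proof -
  define a where "a k = (m choose k) * z ^ k" for k
  have z: "z \<ge> 0" "z * (real m - real h) = h" using assms by auto
  have a_nonneg: "a k \<ge> 0" for k using z by (simp add: a_def)
  have absorb: "real (Suc k) * (m choose Suc k) = (real m - real k) * (m choose k)" if "k \<le> m" for k
  proof -
    have "Suc k * (m choose Suc k) = (m - k) * (m choose k)"
      by (simp only: binomial_absorption binomial_absorb_comp)
    then have "real (Suc k) * (m choose Suc k) = real (m - k) * (m choose k)"
      by (metis of_nat_mult)
    then show ?thesis using that by (simp add: of_nat_diff)
  qed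
  have ratio: "real (Suc k) * a (Suc k) = (real m - real k) * z * a k" if "k \<le> m" for k
  proof -
    have "real (Suc k) * a (Suc k) = (real (Suc k) * (m choose Suc k)) * (z * z ^ k)"
      by (simp add: a_def)
    then show ?thesis unfolding absorb[OF that] by (simp add: a_def)
  qed
  have gap: "(real m - real k) * z = h + (real h - real k) * z" for k
    using z(2) by (simp add: algebra_simps)
  have up: "a k \<le> a (Suc k)" if "k < h" for k
  proof -
    have "(real h - real k) * z \<ge> 0"
      using that z by (intro mult_nonneg_nonneg) auto
    then have "real (Suc k) \<le> (real m - real k) * z"
      using that by (simp add: gap)
    then have "real (Suc k) * a k \<le> real (Suc k) * a (Suc k)"
      using ratio[of k] that assms(1) a_nonneg[of k] by (simp add: mult_right_mono)
    then show ?thesis by simp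
  qed
  have down: "a (Suc k) \<le> a k" if "h \<le> k" for k
  proof (cases "k \<le> m")
    case True
    have "(real k - real h) * z \<ge> 0"
      using that z by (intro mult_nonneg_nonneg) auto
    then have "(real m - real k) * z \<le> real (Suc k)"
      using that unfolding gap by (simp add: algebra_simps)
    then have "real (Suc k) * a (Suc k) \<le> real (Suc k) * a k"
      using ratio[OF True] a_nonneg[of k] by (simp add: mult_right_mono)
    then show ?thesis by simp
  qed (simp add: a_def binomial_eq_0)
  have "a k \<le> a h"
  proof (cases "k \<le> h")
    case True
    then show ?thesis
    proof (induction k rule: inc_induct)
      case (step k)
      then show ?case using up[of k] by simp
    qed simp
  next
    case False
    then have "h \<le> k" by simp
    then show ?thesis
    proof (induction k rule: dec_induct)
      case (step k)
      then show ?case using down[of k] by simp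
    qed simp
  qed
  then show ?thesis by (simp add: a_def)
qed

text \<open>The largest of \<open>m + 1\<close> terms is at least their average.\<close>

lemma power_le_binomial_mode:
  fixes z :: real
  assumes "h < m"
  defines "z \<equiv> real h / (real m - real h)"
  shows "(1 + z) ^ m \<le> Suc m * ((m choose h) * z ^ h)"
proof -
  have "(1 + z) ^ m = (\<Sum>k\<le>m. (m choose k) * z ^ k)"
    using binomial_ring[of z 1 m] by (simp add: add.commute)
  also have "\<dots> \<le> (\<Sum>k\<le>m. (m choose h) * z ^ h)"
    unfolding z_def by (intro sum_mono binomial_term_le_mode assms)
  finally show ?thesis by simp
qed

text \<open>Bernoulli's inequality with its gain made explicit. From \<open>d\<close> to
  \<open>d + 1\<close>, one has \<open>(1 + z) * (1 + d * z) = c * (1 + u)\<close>, while the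
  exponent grows by at most \<open>u / 2\<close> and \<open>exp (u / 2) \<le> 1 + u\<close> for
  \<open>0 \<le> u \<le> 1\<close>.\<close>

lemma Bernoulli_inequality_exp:
  fixes z :: real
  assumes "0 \<le> z" "z \<le> 1"
  shows "(1 + d * z) * exp (d * (real d - 1) * z\<^sup>2 / (4 * (1 + d * z))) \<le> (1 + z) ^ d"
proof (induction d)
  case (Suc d)
  define A where "A d = d * (real d - 1) * z\<^sup>2 / (4 * (1 + d * z))" for d :: nat
  define c where "c = 1 + Suc d * z"
  define u where "u = d * z\<^sup>2 / c"
  have c: "c \<ge> 1" "c \<ge> d * z" using assms by (auto simp: c_def algebra_simps)
  have "d * z * z \<le> c * 1" using assms c by (intro mult_mono) auto
  moreover have "d * z * z \<ge> 0" using assms by simp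
  ultimately have u: "0 \<le> u" "u \<le> 1" using c by (auto simp: u_def divide_simps power2_eq_square mult_ac)
  have "real d * (real d - 1) \<ge> 0" by (cases d) auto
  then have "real d * (real d - 1) * z\<^sup>2 / (4 * c) \<le> A d"
    unfolding A_def
  proof (intro divide_left_mono mult_pos_pos mult_nonneg_nonneg[of "real d * (real d - 1)"])
    show "0 < 1 + real d * z" "4 * (1 + real d * z) \<le> 4 * c" "0 < c"
      using assms c by (auto simp: c_def algebra_simps add_pos_nonneg)
  qed auto
  moreover have "A (Suc d) = real d * (real d - 1) * z\<^sup>2 / (4 * c) + u / 2"
    unfolding A_def u_def c_def[symmetric] using c by (simp add: field_simps)
  ultimately have "A (Suc d) \<le> A d + u / 2" by simp
  then have "exp (A (Suc d)) \<le> exp (A d) * exp (u / 2)"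
    by (simp flip: exp_add)
  also have "exp (u / 2) \<le> 1 + u / 2 + (u / 2)\<^sup>2"
    using u by (intro exp_bound) auto
  also have "(u / 2)\<^sup>2 \<le> u / 2"
    using u mult_mono[of u 1 u u] by (simp add: power2_eq_square)
  finally have "exp (A (Suc d)) \<le> exp (A d) * (1 + u)" by (simp add: add.commute)
  then have "c * exp (A (Suc d)) \<le> c * (exp (A d) * (1 + u))"
    using c by (intro mult_left_mono) auto
  also have "\<dots> = (1 + z) * ((1 + d * z) * exp (A d))"
  proof -
    have "c * (1 + u) = (1 + z) * (1 + d * z)"
      using c by (simp add: u_def field_simps) (simp add: c_def power2_eq_square algebra_simps)
    then show ?thesis by (simp add: mult_ac)
  qed
  also have "\<dots> \<le> (1 + z) * (1 + z) ^ d"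
    using Suc assms unfolding A_def by (intro mult_left_mono) auto
  finally show ?case by (simp add: c_def A_def)
qed simp

text \<open>\<open>B\<close> is a common bound for the denominators \<open>1 + d * z\<close>, so
  that the exponents add up.\<close>

lemma prod_mset_le_power_exp:
  fixes z B :: real
  assumes "0 \<le> z" "z \<le> 1" "\<And>d. d \<in># M \<Longrightarrow> 1 + d * z \<le> B"
  shows "(\<Prod>d\<in>#M. 1 + d * z) \<le> (1 + z) ^ sum_mset M * exp (- (\<Sum>d\<in>#M. d * (real d - 1)) * z\<^sup>2 / (4 * B))"
  using assms(3)
proof (induction M)
  case (add d M)
  define e where "e = d * (real d - 1) * z\<^sup>2 / (4 * B)"
  have "real d * (real d - 1) \<ge> 0" by (cases d) auto
  then have "e \<le> d * (real d - 1) * z\<^sup>2 / (4 * (1 + d * z))"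
    unfolding e_def using assms add.prems[of d]
    by (intro divide_left_mono mult_pos_pos) (auto simp: add_pos_nonneg intro: less_le_trans[of 0 "1 + d * z"])
  then have "(1 + d * z) * exp e \<le> (1 + d * z) * exp (d * (real d - 1) * z\<^sup>2 / (4 * (1 + d * z)))"
    using assms by (intro mult_left_mono) auto
  also have "\<dots> \<le> (1 + z) ^ d"
    by (rule Bernoulli_inequality_exp) (use assms in auto)
  finally have "1 + d * z \<le> (1 + z) ^ d * exp (- e)"
    by (simp add: exp_minus field_simps)
  then have "(1 + d * z) * (\<Prod>d\<in>#M. 1 + d * z)
    \<le> ((1 + z) ^ d * exp (- e)) * ((1 + z) ^ sum_mset M * exp (- (\<Sum>d\<in>#M. d * (real d - 1)) * z\<^sup>2 / (4 * B)))"
  proof (intro mult_mono)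
    show "(\<Prod>d\<in>#M. 1 + d * z) \<ge> 0"
      using assms(1) by (induction M) auto
  qed (use assms add in auto)
  also have "\<dots> = (1 + z) ^ sum_mset (add_mset d M)
      * exp (- (\<Sum>d\<in>#add_mset d M. d * (real d - 1)) * z\<^sup>2 / (4 * B))"
  proof -
    have "exp (- (\<Sum>d\<in>#add_mset d M. d * (real d - 1)) * z\<^sup>2 / (4 * B))
      = exp (- e + - (\<Sum>d\<in>#M. d * (real d - 1)) * z\<^sup>2 / (4 * B))"
      unfolding e_def by (simp add: algebra_simps diff_divide_distrib add_divide_distrib)
    then show ?thesis
      by (simp only: exp_add power_add sum_mset.add_mset mult_ac)
  qed
  finally show ?case by simp
qed simp

text \<open>At this \<open>z\<close>, replacing \<open>(1 + z) ^ m\<close> by the binomial term at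
  its mode costs only a factor \<open>Suc m\<close>. The power \<open>z ^ h\<close> then cancels,
  and the exponential gain remains.\<close>

lemma esym_tail:
  fixes z D :: real
  assumes sum: "sum_mset M = m" "size M = Suc m" and h: "2 * h \<le> m" "h > 0"
  defines "z \<equiv> real h / (real m - real h)" and "D \<equiv> (\<Sum>d\<in>#M. d * (real d - 1))"
  shows "size M * (esym M h / (size M choose h))
    \<le> (real (size M))\<^sup>2 * exp (- D * z\<^sup>2 / (4 * (1 + z + z * sqrt D)))"
proof -
  define B where "B = 1 + z + z * sqrt D"
  have z: "0 < z" "z \<le> 1" using h by (auto simp: z_def divide_simps)
  have nonneg: "real d * (real d - 1) \<ge> 0" for d by (cases d) auto
  \<comment> \<open>For \<open>d > 0\<close>, \<open>(d - 1)^2 \<le> d * (d - 1) \<le> D\<close>;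
    hence every degree is at most \<open>1 + sqrt D\<close>.\<close>
  have B: "1 + d * z \<le> B" if "d \<in># M" for d
  proof -
    have D: "D = d * (real d - 1) + (\<Sum>d\<in>#M - {#d#}. d * (real d - 1))"
      unfolding D_def using that by (auto dest!: multi_member_split)
    have "(real d - 1)\<^sup>2 \<le> D" if "d > 0"
    proof -
      have "(real d - 1)\<^sup>2 \<le> d * (real d - 1)"
        using that unfolding power2_eq_square by (intro mult_right_mono) auto
      also have "\<dots> \<le> D"
        unfolding D using sum_mset_nonneg[of "\<lambda>d. real d * (real d - 1)", OF nonneg] by simp
      finally show ?thesis .
    qed
    moreover have "D \<ge> 0"
      unfolding D_def by (intro sum_mset_nonneg nonneg)
    ultimately have "real d - 1 \<le> sqrt D"
      by (cases "d > 0") (auto intro: real_le_rsqrt order_trans[of _ 0])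
    then have "real d * z \<le> (1 + sqrt D) * z"
      using z by (intro mult_right_mono) auto
    then show ?thesis by (simp add: B_def algebra_simps)
  qed
  define E where "E = exp (- D * z\<^sup>2 / (4 * B))"
  have "esym M h * z ^ h \<le> (\<Prod>d\<in>#M. 1 + d * z)"
    using z by (intro esym_power_le) auto
  also have "\<dots> \<le> (1 + z) ^ m * E"
    unfolding E_def D_def sum(1)[symmetric] using z B by (intro prod_mset_le_power_exp) auto
  also have "\<dots> \<le> (Suc m * ((m choose h) * z ^ h)) * E"
    unfolding z_def using h by (intro mult_right_mono power_le_binomial_mode) (auto simp: E_def)
  finally have "esym M h * z ^ h \<le> (real (Suc m) * (m choose h) * E) * z ^ h"
    by (simp only: mult_ac)
  then have "esym M h \<le> real (Suc m) * (m choose h) * E"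
    using z by simp
  also have "\<dots> \<le> real (Suc m) * (Suc m choose h) * E"
  proof -
    have "m choose h \<le> Suc m choose h" by (cases h) auto
    then show ?thesis
      by (intro mult_right_mono mult_left_mono) (auto simp: E_def)
  qed
  finally have "esym M h \<le> Suc m * E * (size M choose h)"
    by (simp add: sum mult_ac)
  moreover have "size M choose h > 0" using h sum by simp
  ultimately have "esym M h / (size M choose h) \<le> Suc m * E"
    by (simp add: pos_divide_le_eq)
  then have "size M * (esym M h / (size M choose h)) \<le> size M * (Suc m * E)"
    by (intro mult_left_mono) auto
  then show ?thesis by (simp add: sum power2_eq_square E_def B_def)
qed

subsection \<open>Combining the two estimates\<close>

lemma sum_step: "(\<Sum>c\<in>#M. step c) = real (sum_mset M) - size M"
  by (induction M) auto

text \<open>For total - 1 this reads \<open>v = D + 1\<close>, which links the width bound to the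
  height bound.\<close>

lemma sum_step_squares:
  "(\<Sum>c\<in>#M. (step c)\<^sup>2) = (\<Sum>c\<in>#M. c * (real c - 1)) - (\<Sum>c\<in>#M. step c)"
  by (induction M) (auto simp: power2_eq_square algebra_simps)

lemma prob_wide_trees:
  fixes w :: real
  assumes sum: "(\<Sum>c\<in>#M. step c) = - 1" and M: "size M \<ge> 2" and w: "w \<ge> 8"
  shows "card {t \<in> deg_trees M. real (tree_width t) \<ge> w}
    \<le> 160 * (\<Sum>c\<in>#M. (step c)\<^sup>2) / w\<^sup>2 * card (deg_trees M)"
proof -
  define v where "v = (\<Sum>c\<in>#M. (step c)\<^sup>2)"
  define W where "W = real (card {t \<in> deg_trees M. real (tree_width t) \<ge> w})"
  have nonneg: "real d * (real d - 1) \<ge> 0" for d by (cases d) auto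
  have v: "v \<ge> 1"
    using sum_mset_nonneg[of "\<lambda>c. real c * (real c - 1)" M, OF nonneg]
    unfolding v_def sum_step_squares sum by simp
  \<comment> \<open>\<open>w - 4 \<ge> w / 2\<close> and \<open>v \<ge> 1\<close> turn
    \<open>8 * (1 + 4 * v) / (w - 4)^2\<close> into \<open>160 * v / w^2\<close>.\<close>
  have "(w / 2)\<^sup>2 * W \<le> (w - 4)\<^sup>2 * W"
    using w by (intro mult_right_mono power_mono) (auto simp: W_def)
  also have "\<dots> \<le> 8 * (1 + 4 * v) * card (deg_trees M)"
    unfolding W_def v_def using assms by (intro card_wide_trees) auto
  also have "\<dots> \<le> (40 * v) * card (deg_trees M)"
    using v by (intro mult_right_mono) auto
  finally have "W \<le> 160 * v / w\<^sup>2 * card (deg_trees M)"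
    using w by (simp add: field_simps power2_eq_square)
  then show ?thesis by (simp add: W_def v_def)
qed

text \<open>With \<open>y = z * sqrt D\<close> the exponent in \<open>esym_tail\<close> is
  \<open>- (y^2) / (4 * (1 + z + y))\<close>. The bound on \<open>h\<close> gives
  \<open>y \<ge> 24 * L\<close>, so \<open>1 + z \<le> y\<close> and the exponent is at most
  \<open>- y / 8 \<le> - 3 * L\<close>, which turns \<open>n^2\<close> into
  \<open>1 / n\<close>.\<close>

lemma prob_high_trees:
  fixes L v :: real
  assumes sum: "(\<Sum>c\<in>#M. step c) = - 1"
    and L: "L = ln (real (size M))" "L \<ge> 1"
    and v: "v = (\<Sum>c\<in>#M. (step c)\<^sup>2)" "sqrt v \<ge> 108 * L"
    and h: "real h \<ge> 36 * real (size M) * L / sqrt v" "2 * h < size M"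
  shows "card {t \<in> deg_trees M. tree_height t \<ge> h} \<le> 1 / size M * card (deg_trees M)"
proof -
  define n where "n = real (size M)"
  obtain m where m: "size M = Suc m"
    using h by (cases "size M") auto
  then have "real (sum_mset M) = real m"
    using sum unfolding sum_step by simp
  then have sum_M: "sum_mset M = m"
    by (simp only: of_nat_eq_iff)
  have n: "n > 0" using m by (simp add: n_def)
  have sqrt_v: "sqrt v \<ge> 108" using v(2) L(2) by linarith
  have h_pos: "h > 0"
  proof -
    have "36 * real (size M) * L / sqrt v > 0"
      using n L(2) sqrt_v unfolding n_def by (intro divide_pos_pos mult_pos_pos) linarith+
    then show ?thesis using h(1) by linarith
  qed
  define z where "z = real h / (real m - real h)"
  define D where "D = (\<Sum>d\<in>#M. d * (real d - 1))"
  have z: "0 < z" "z \<le> 1" using h m h_pos by (auto simp: z_def divide_simps)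
  have D: "v = D + 1"
    unfolding v sum_step_squares sum D_def by simp
  define y where "y = z * sqrt D"
  have "z \<ge> h / n"
    unfolding z_def n_def using h(2) h_pos m by (intro divide_left_mono mult_pos_pos) auto
  also have "h / n \<ge> (36 * n * L / sqrt v) / n"
    using h n by (intro divide_right_mono) (auto simp: n_def)
  also have "(36 * n * L / sqrt v) / n = 36 * L / sqrt v"
    using n by simp
  finally have z_ge: "z \<ge> 36 * L / sqrt v" .
  have "v \<ge> 108\<^sup>2"
    using sqrt_v real_le_lsqrt by (metis real_sqrt_le_iff real_sqrt_pow2_iff real_sqrt_abs abs_numeral)
  \<comment> \<open>A crude constant with rational root 2 / 3, so that 36 becomes 24 in the bound on
    \<open>y\<close>.\<close>
  then have "(4 / 9) * v \<le> D" using D by simp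
  then have "sqrt ((4 / 9) * v) \<le> sqrt D" by (rule real_sqrt_le_mono)
  then have "(2 / 3) * sqrt v \<le> sqrt D"
    by (simp add: real_sqrt_mult real_sqrt_divide)
  then have "(36 * L / sqrt v) * ((2 / 3) * sqrt v) \<le> y"
    unfolding y_def using z z_ge \<open>v \<ge> 108\<^sup>2\<close> by (intro mult_mono) auto
  moreover have "sqrt v > 0" using sqrt_v by linarith
  ultimately have y: "24 * L \<le> y" by simp
  have "3 * L \<le> y / 8" using y by simp
  also have "y / 8 = y\<^sup>2 / (4 * (2 * y))"
    using y L(2) by (simp add: power2_eq_square)
  also have "\<dots> \<le> y\<^sup>2 / (4 * (1 + z + y))"
    using y L(2) z by (intro divide_left_mono mult_pos_pos) auto
  also have "y\<^sup>2 = D * z\<^sup>2"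
    using \<open>(4 / 9) * v \<le> D\<close> \<open>v \<ge> 108\<^sup>2\<close> by (simp add: y_def power_mult_distrib mult.commute)
  finally have "- D * z\<^sup>2 / (4 * (1 + z + y)) \<le> - 3 * L" by simp
  then have "exp (- D * z\<^sup>2 / (4 * (1 + z + y))) \<le> exp (- 3 * L)" by simp
  also have "exp (- 3 * L) = 1 / n ^ 3"
  proof -
    have "exp (3 * L) = exp L ^ 3" by (metis exp_of_nat_mult of_nat_numeral)
    then show ?thesis using n by (simp add: L(1) n_def exp_minus field_simps)
  qed
  finally have "n\<^sup>2 * exp (- D * z\<^sup>2 / (4 * (1 + z + y))) \<le> n\<^sup>2 * (1 / n ^ 3)"
    by (intro mult_left_mono) auto
  also have "\<dots> = 1 / n" using n by (simp add: power2_eq_square power3_eq_cube)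
  finally have "size M * (esym M h / (size M choose h)) \<le> 1 / n"
    using esym_tail[OF sum_M m, of h] h m h_pos unfolding n_def y_def z_def D_def by simp
  then have "size M * (esym M h / (size M choose h)) * card (deg_trees M) \<le> 1 / n * card (deg_trees M)"
    by (intro mult_right_mono) auto
  then show ?thesis using card_high_trees[OF sum, of h] by (simp add: n_def)
qed

text \<open>For \<open>s > n\<close> the event is empty. For small \<open>v\<close> the width bound
  suffices. Otherwise the height is cut at \<open>x\<close> and the width at \<open>w\<close> with
  \<open>w * x = s * n * L\<close>, and each event contributes at most \<open>1 / s\<close>.\<close>

lemma prob_width_height_le:
  fixes s :: real
  assumes sum: "(\<Sum>c\<in>#M. step c) = - 1" and M: "size M \<ge> 3" and s: "s \<ge> 10 ^ 7"
  shows "card {t \<in> deg_trees M. real (tree_width t) * real (tree_height t) \<ge> s * size M * ln (size M)}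
    \<le> 2 / s * card (deg_trees M)"
proof -
  define n where "n = real (size M)"
  define L where "L = ln n"
  define v where "v = (\<Sum>c\<in>#M. (step c)\<^sup>2)"
  define F where "F = real (card (deg_trees M))"
  define A where "A = {t \<in> deg_trees M. real (tree_width t) * real (tree_height t) \<ge> s * n * L}"
  have n: "n \<ge> 3" using M by (simp add: n_def)
  have "exp 1 \<le> n" using exp_le n by linarith
  then have L: "L \<ge> 1" using n by (simp add: L_def ln_ge_iff)
  have F: "F \<ge> 0" by (simp add: F_def)
  have width: "real (tree_width t) \<le> n" and height: "real (tree_height t) \<le> n" if "t \<in> A" for t
    using that tree_width_eq[of t] level_size_le[of _ t] tree_height_le[of t]
    by (auto simp: A_def deg_trees_def n_def)
  have wide: "real (card {t \<in> deg_trees M. real (tree_width t) \<ge> w}) \<le> 160 * v / w\<^sup>2 * F" if "w \<ge> 8" for w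
    unfolding v_def F_def by (rule prob_wide_trees) (use sum M that in auto)
  have mono: "real (card X) \<le> card Y" if "X \<subseteq> Y" "Y \<subseteq> deg_trees M" for X Y
    using that card_mono[of Y X] finite_subset[OF _ finite_deg_trees[of M]] by auto
  have "card A \<le> 2 / s * F"
  proof (cases "s > n")
    case True
    have "A = {}"
    proof (rule ccontr)
      assume "A \<noteq> {}"
      then obtain t where t: "t \<in> A" by auto
      have "s * n * 1 \<le> s * n * L" using s n L by (intro mult_left_mono) auto
      also have "\<dots> \<le> real (tree_width t) * real (tree_height t)" using t by (simp add: A_def)
      also have "\<dots> \<le> n * n" using width[OF t] height[OF t] n by (intro mult_mono) auto
      finally show False using True n by simp
    qed
    then show ?thesis using s F by simp
  next
    case False
    show ?thesis
    proof (cases "sqrt v \<le> 108 * L")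
      case True
      \<comment> \<open>the trivial bound \<open>n\<close> on the height suffices\<close>
      have "A \<subseteq> {t \<in> deg_trees M. real (tree_width t) \<ge> s * L}"
      proof
        fix t assume t: "t \<in> A"
        have "s * L * n \<le> real (tree_width t) * real (tree_height t)"
          using t by (simp add: A_def mult_ac)
        also have "\<dots> \<le> real (tree_width t) * n"
          using height[OF t] by (intro mult_left_mono) auto
        finally show "t \<in> {t \<in> deg_trees M. real (tree_width t) \<ge> s * L}"
          using t n by (simp add: A_def)
      qed
      then have "card A \<le> real (card {t \<in> deg_trees M. real (tree_width t) \<ge> s * L})"
        by (intro mono) auto
      also have "\<dots> \<le> 160 * v / (s * L)\<^sup>2 * F"
        using s L mult_mono[of 8 s 1 L] by (intro wide) auto
      also have "\<dots> \<le> 2 / s * F"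
      proof (intro mult_right_mono)
        have "v \<ge> 0" unfolding v_def by (intro sum_mset_nonneg) auto
        then have "v \<le> (108 * L)\<^sup>2"
          using power_mono[OF True, of 2] by simp
        then have "160 * v * s \<le> 160 * (108 * L)\<^sup>2 * s"
          using s by (intro mult_right_mono) auto
        \<comment> \<open>\<open>1866240 = 160 * 108^2\<close>, which is below
          \<open>2 * s\<close>.\<close>
        also have "\<dots> = 1866240 * (s * L\<^sup>2)" by (simp add: power_mult_distrib)
        also have "\<dots> \<le> (2 * s) * (s * L\<^sup>2)"
          using s by (intro mult_right_mono) auto
        finally show "160 * v / (s * L)\<^sup>2 \<le> 2 / s"
          using s L by (simp add: divide_simps) (simp add: power2_eq_square mult_ac)
      qed (rule F)
      finally show ?thesis .
    next
      case large: False
      define x where "x = 36 * n * L / sqrt v"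
      define h where "h = nat \<lceil>x\<rceil>"
      have sqrt_v: "sqrt v \<ge> 108 * L" "sqrt v \<ge> 108" using large L by linarith+
      have "sqrt v > 0" using sqrt_v(2) by linarith
      then have v: "v > 0" by simp
      have x: "x \<ge> 0" unfolding x_def using n L v by (intro divide_nonneg_nonneg) auto
      \<comment> \<open>With \<open>x \<le> n / 3\<close> and \<open>n > 6\<close>, rounding up
        still leaves \<open>2 * h < n\<close>.\<close>
      have "x \<le> 36 * n * L / (108 * L)"
        unfolding x_def using n L sqrt_v v by (intro divide_left_mono mult_pos_pos) auto
      then have "x \<le> n / 3" using L by simp
      moreover have h: "x \<le> h" "h < x + 1" using x unfolding h_def by linarith+
      moreover have "n \<ge> 10 ^ 7" using False s by linarith
      then have "n > 6" by simp
      ultimately have "2 * real h < n" by linarith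
      then have h_less: "2 * h < size M" unfolding n_def by linarith
      define w where "w = s * sqrt v / 36"
      have "A \<subseteq> {t \<in> deg_trees M. tree_height t \<ge> h} \<union> {t \<in> deg_trees M. real (tree_width t) \<ge> w}"
      proof
        fix t assume t: "t \<in> A"
        show "t \<in> {t \<in> deg_trees M. tree_height t \<ge> h} \<union> {t \<in> deg_trees M. real (tree_width t) \<ge> w}"
        proof (cases "tree_height t \<ge> h")
          case True
          then show ?thesis using t by (simp add: A_def)
        next
          case False
          \<comment> \<open>Rounding loses nothing: a natural number below the ceiling of
            \<open>x\<close> is at most \<open>x\<close>.\<close>
          then have "real (tree_height t) \<le> x" using h by linarith
          then have "real (tree_width t) * real (tree_height t) \<le> real (tree_width t) * x"
            by (intro mult_left_mono) auto
          then have "s * n * L \<le> real (tree_width t) * x" using t by (simp add: A_def)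
          moreover have "s * n * L = w * x"
            using v by (simp add: w_def x_def)
          moreover have "x > 0"
            unfolding x_def using n L sqrt_v(2) by (intro divide_pos_pos mult_pos_pos) linarith+
          ultimately have "w \<le> real (tree_width t)" by simp
          then show ?thesis using t by (simp add: A_def)
        qed
      qed
      then have "card A \<le> real (card ({t \<in> deg_trees M. tree_height t \<ge> h} \<union> {t \<in> deg_trees M. real (tree_width t) \<ge> w}))"
        by (intro mono) auto
      also have "\<dots> \<le> real (card {t \<in> deg_trees M. tree_height t \<ge> h}) + real (card {t \<in> deg_trees M. real (tree_width t) \<ge> w})"
        using of_nat_mono[OF card_Un_le, where 'a = real] by simp
      also have "\<dots> \<le> 1 / s * F + 1 / s * F"
      proof (rule add_mono)
        have "real (card {t \<in> deg_trees M. tree_height t \<ge> h}) \<le> 1 / size M * card (deg_trees M)"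
          by (rule prob_high_trees[where L = L and v = v])
            (use sum L sqrt_v h h_less in \<open>auto simp: L_def n_def v_def x_def\<close>)
        also have "\<dots> \<le> 1 / s * F"
          unfolding F_def using False s n by (intro mult_right_mono frac_le) (auto simp: n_def)
        finally show "real (card {t \<in> deg_trees M. tree_height t \<ge> h}) \<le> 1 / s * F" .
        have "w \<ge> 10 ^ 7 * 108 / 36"
          unfolding w_def using s sqrt_v by (intro divide_right_mono mult_mono) auto
        then have "real (card {t \<in> deg_trees M. real (tree_width t) \<ge> w}) \<le> 160 * v / w\<^sup>2 * F"
          by (intro wide) simp
        also have "\<dots> \<le> 1 / s * F"
        proof (intro mult_right_mono)
          \<comment> \<open>\<open>207360 = 160 * 36^2\<close>; \<open>v\<close> cancels because
            \<open>w\<close> is proportional to \<open>sqrt v\<close>.\<close>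
          have "160 * v / w\<^sup>2 = 207360 / s\<^sup>2"
            using v by (simp add: w_def power_divide power_mult_distrib)
          also have "\<dots> \<le> 1 / s"
            using s by (simp add: divide_simps power2_eq_square)
          finally show "160 * v / w\<^sup>2 \<le> 1 / s" .
        qed (rule F)
        finally show "real (card {t \<in> deg_trees M. real (tree_width t) \<ge> w}) \<le> 1 / s * F" .
      qed
      finally show ?thesis by simp
    qed
  qed
  then show ?thesis by (simp add: A_def F_def L_def n_def)
qed

section \<open>From type sequences to degree multisets\<close>

text \<open>The topology on \<open>nat\<close> is discrete, so that a convergent series of naturals is eventually zero.\<close>

lemma sums_nat_finite_support:
  fixes N :: "nat \<Rightarrow> nat"
  assumes "N sums n"
  shows "\<exists>K. (\<forall>i\<ge>K. N i = 0) \<and> (\<Sum>i<K. N i) = n"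
proof -
  have "eventually (\<lambda>k. (\<Sum>i<k. N i) = n) sequentially"
    using assms unfolding sums_def by (simp add: tendsto_discrete)
  then obtain K where K: "\<And>k. k \<ge> K \<Longrightarrow> (\<Sum>i<k. N i) = n"
    by (auto simp: eventually_sequentially)
  have "N i = 0" if "i \<ge> K" for i
    using K[of i] K[of "Suc i"] that by simp
  then show ?thesis using K by blast
qed

lemma has_type_iff: "has_type t N \<longleftrightarrow> count (degs t) = N"
  by (auto simp: has_type_def card_num_children_eq_count fun_eq_iff)

theorem theorem1p4:
  fixes N :: "nat \<Rightarrow> nat" and n :: nat and s :: real
  assumes "N sums n"
    and "summable (\<lambda>i. i * N i)" and "1 + (\<Sum>i. i * N i) = n"
    and "n \<ge> 3"
    and "s > 0"
  shows "measure_pmf.prob (pmf_of_set {t. has_type t N})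
           {t. real (tree_width t) * real (tree_height t) \<ge> s * real n * ln (real n)}
         \<le> 230 * s powr (- 2 / 13)"
proof (cases "s \<ge> 10 ^ 7")
  case False
  have "measure_pmf.prob (pmf_of_set {t. has_type t N})
           {t. real (tree_width t) * real (tree_height t) \<ge> s * real n * ln (real n)} \<le> 1"
    by simp
  \<comment> \<open>For small \<open>s\<close> the claimed bound exceeds 1: even at
    \<open>s = 10 ^ 13\<close> the power \<open>s powr (2 / 13)\<close> is only 100.\<close>
  also have "1 \<le> 230 * s powr (- 2 / 13)"
  proof -
    have "s powr (2 / 13) \<le> (10 ^ 13) powr (2 / 13)"
      using False assms(5) by (intro powr_mono2) auto
    also have "(10 ^ 13 :: real) = 10 powr 13" by (simp add: powr_numeral)
    also have "(10 powr 13) powr (2 / 13) = (100 :: real)"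
      by (simp add: powr_powr)
    finally have "s powr (2 / 13) \<le> 230" by simp
    moreover have "s powr (- 2 / 13) = 1 / s powr (2 / 13)"
      using powr_minus_divide[of s "2 / 13"] by simp
    moreover have "s powr (2 / 13) > 0" using assms(5) by simp
    ultimately show ?thesis by (simp add: le_divide_eq)
  qed
  finally show ?thesis .
next
  case True
  obtain K where "(\<forall>i\<ge>K. N i = 0) \<and> (\<Sum>i<K. N i) = n"
    using sums_nat_finite_support[OF assms(1)] ..
  then have K: "\<And>i. i \<ge> K \<Longrightarrow> N i = 0" "(\<Sum>i<K. N i) = n"
    by auto
  have support: "i < K" if "N i > 0" for i
    using that by (metis K(1) leI less_irrefl)
  then have "{i. N i > 0} \<subseteq> {..<K}" by auto
  then have finite: "finite {i. N i > 0}"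
    by (rule finite_subset) simp
  obtain M where M: "count M = N"
    by (rule that[OF count_Abs_multiset[OF finite]])
  have set_M: "set_mset M \<subseteq> {..<K}"
  proof
    fix i assume "i \<in># M"
    then have "count M i > 0" by simp
    then show "i \<in> {..<K}" using support M by simp
  qed
  have "(\<Sum>i. i * N i) = (\<Sum>i<K. i * N i)"
    using K(1) by (intro suminf_finite) auto
  then have "real (1 + (\<Sum>i<K. i * N i)) = real n"
    using assms(3) by (simp only:)
  then have total: "1 + (\<Sum>i<K. real i * real (N i)) = real n"
    by (simp only: of_nat_add of_nat_1 of_nat_sum of_nat_mult)
  have "real (size M) = (\<Sum>i<K. real (N i))"
    using sum_mset_count[of "{..<K}" M "\<lambda>_. 1"] set_M by (simp add: M)
  then have size_M: "size M = n"
    using K(2)[THEN arg_cong, of real] by simp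
  have "(\<Sum>c\<in>#M. step c) = (\<Sum>i<K. real (N i) * step i)"
    using sum_mset_count[of "{..<K}" M step] set_M by (simp add: M)
  also have "\<dots> = (\<Sum>i<K. real i * real (N i)) - (\<Sum>i<K. real (N i))"
    by (simp add: algebra_simps sum_subtractf)
  also have "\<dots> = - 1"
    using total K(2)[THEN arg_cong, of real] by simp
  finally have sum: "(\<Sum>c\<in>#M. step c) = - 1" .
  have trees: "{t. has_type t N} = deg_trees M"
    by (auto simp: deg_trees_def has_type_iff M[symmetric] count_inject)
  \<comment> \<open>\<open>pmf_of_set\<close> is uniform only on a finite nonempty set; the cycle
    lemma shows that trees of the given type exist.\<close>
  have "card (permutations_of_multiset M) \<noteq> 0"
    by simp
  then have "card (deg_trees M) \<noteq> 0"
    using card_trees[OF sum] bij_betw_same_card[OF bij_betw_deg_trees[of M]] by (intro notI) simp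
  then have ne: "deg_trees M \<noteq> {}" and pos: "real (card (deg_trees M)) > 0" by auto
  have "card {t \<in> deg_trees M. real (tree_width t) * real (tree_height t) \<ge> s * real n * ln (real n)}
      \<le> 2 / s * card (deg_trees M)"
    using prob_width_height_le[OF sum _ True] assms(4) by (simp add: size_M)
  then have "measure_pmf.prob (pmf_of_set {t. has_type t N})
      {t. real (tree_width t) * real (tree_height t) \<ge> s * real n * ln (real n)} \<le> 2 / s"
    unfolding trees measure_pmf_of_set[OF ne finite_deg_trees]
    using pos by (simp add: pos_divide_le_eq Int_def)
  also have "2 / s \<le> 230 * s powr (- 1)"
    using True by (simp add: powr_minus field_simps)
  also have "\<dots> \<le> 230 * s powr (- 2 / 13)"
    using True by (intro mult_left_mono powr_mono) auto
  finally show ?thesis .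
qed

end
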